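(* Let $\mathbf{d}=(d_1,\ldots,d_n)$ be a graphic arranged sequence of positive integers. Then $\nu^*(\mathbf{d})$ equals the maximum of those integers $\mu$ with $1\le 2\mu\le n$ satisfying both: (a) for every integer $k$ with $1\le k<\mu$, $$\sum_{i=1}^k d_i\le k^2+\sum_{i=k+1}^n \min\{d_i-I_{i\le 2\mu},\,k\};$$ (b) for $k=2\mu+t_{\mathbf{d}}(2\mu)$, $$\sum_{i=1}^k d_i-k+\big|\{i>2\mu : d_i=d_{2\mu}\}\big|\le k(k-1)+\sum_{i=k+1}^n\min\{d_i-I_{d_i=d_{2\mu}},\,k\}.$$
   Context: A finite sequence of nonnegative integers is graphic if it is the degree sequence of some simple graph (a realization). Arranged means $d_1\ge\cdots\ge d_n$. $\nu^*(\mathbf{d})$ is the maximum of the matching number $\nu(G)$ (maximum number of pairwise disjoint edges) over all labelled simple graph realizations $G$ of $\mathbf{d}$. For an index $\delta$, $t_{\mathbf{d}}(\delta)=|\{i>\delta : d_i=d_\delta\}|-|\{i\le\delta: d_i=d_\delta\}|$. $I_{i\le 2\mu}$ equals $1$ if $i\le 2\mu$ and $0$ otherwise; $I_{d_i=d_{2\mu}}$ equals $1$ if $d_i=d_{2\mu}$ and $0$ otherwise. Empty sums are $0$. *)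

theory Defs
  imports Main
begin

text \<open>
  A sequence \<open>(d\<^sub>1, \<dots>, d\<^sub>n)\<close> is a pair of a length \<open>n\<close> and a function \<open>d\<close>, of which only the
  values on \<open>{1..n}\<close> matter. A simple graph is given by its vertex set and a set of two-element
  sets of vertices.
\<close>

definition simple_graph :: "'a set \<Rightarrow> 'a set set \<Rightarrow> bool" where
  "simple_graph V E \<longleftrightarrow> finite V \<and> (\<forall>e\<in>E. e \<subseteq> V \<and> card e = 2)"

definition degree :: "'a set set \<Rightarrow> 'a \<Rightarrow> nat" where
  "degree E v = card {e \<in> E. v \<in> e}"

definition matching :: "'a set set \<Rightarrow> 'a set set \<Rightarrow> bool" where
  "matching E M \<longleftrightarrow> M \<subseteq> E \<and> pairwise disjnt M"

definition matching_number :: "'a set set \<Rightarrow> nat" where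
  "matching_number E = Max {card M | M. matching E M}"

definition realization :: "nat \<Rightarrow> (nat \<Rightarrow> nat) \<Rightarrow> nat set set \<Rightarrow> bool" where
  "realization n d E \<longleftrightarrow> simple_graph {1..n} E \<and> (\<forall>i\<in>{1..n}. degree E i = d i)"

definition graphic :: "nat \<Rightarrow> (nat \<Rightarrow> nat) \<Rightarrow> bool" where
  "graphic n d \<longleftrightarrow> (\<exists>E. realization n d E)"

definition max_matching_number :: "nat \<Rightarrow> (nat \<Rightarrow> nat) \<Rightarrow> nat" where
  "max_matching_number n d = Max {matching_number E | E. realization n d E}"

definition tshift :: "nat \<Rightarrow> (nat \<Rightarrow> nat) \<Rightarrow> nat \<Rightarrow> int" where
  "tshift n d \<delta> = int (card {i \<in> {1..n}. i > \<delta> \<and> d i = d \<delta>})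
                - int (card {i \<in> {1..n}. i \<le> \<delta> \<and> d i = d \<delta>})"

definition condition_a :: "nat \<Rightarrow> (nat \<Rightarrow> nat) \<Rightarrow> nat \<Rightarrow> bool" where
  "condition_a n d \<mu> \<longleftrightarrow>
     (\<forall>k. 1 \<le> k \<and> k < \<mu> \<longrightarrow>
        (\<Sum>i=1..k. int (d i))
          \<le> (int k)\<^sup>2 + (\<Sum>i=k+1..n. min (int (d i) - of_bool (i \<le> 2 * \<mu>)) (int k)))"

text \<open>
  The conversion by \<open>nat\<close> below does not truncate; see \<open>add_tshift_nonneg\<close>.
\<close>

definition condition_b :: "nat \<Rightarrow> (nat \<Rightarrow> nat) \<Rightarrow> nat \<Rightarrow> bool" where
  "condition_b n d \<mu> \<longleftrightarrow>
     (let k = nat (int (2 * \<mu>) + tshift n d (2 * \<mu>)) in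
        (\<Sum>i=1..k. int (d i)) - int k + int (card {i \<in> {1..n}. i > 2 * \<mu> \<and> d i = d (2 * \<mu>)})
          \<le> int k * (int k - 1)
             + (\<Sum>i=k+1..n. min (int (d i) - of_bool (d i = d (2 * \<mu>))) (int k)))"

lemma add_tshift_nonneg: "0 \<le> int \<delta> + tshift n d \<delta>"
proof -
  have "card {i \<in> {1..n}. i \<le> \<delta> \<and> d i = d \<delta>} \<le> card {1..\<delta>}"
    by (rule card_mono) auto
  then show ?thesis
    by (simp add: tshift_def)
qed

text \<open>
  The maxima in \<open>matching_number\<close> and \<open>max_matching_number\<close> range over finite nonempty sets.
\<close>

lemma simple_graph_finite_edges:
  assumes "simple_graph V E"
  shows "finite E"
proof (rule finite_subset)
  show "E \<subseteq> Pow V" "finite (Pow V)"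
    using assms by (auto simp: simple_graph_def)
qed

lemma matching_sizes_finite_nonempty:
  assumes "simple_graph V E"
  shows "finite {card M | M. matching E M}" "{card M | M. matching E M} \<noteq> {}"
proof -
  have "finite {M. matching E M}"
    using simple_graph_finite_edges[OF assms] by (auto simp: matching_def)
  then show "finite {card M | M. matching E M}"
    by simp
  have "matching E {}"
    by (simp add: matching_def)
  then show "{card M | M. matching E M} \<noteq> {}"
    by blast
qed

lemma realization_matching_numbers_finite_nonempty:
  assumes "graphic n d"
  shows "finite {matching_number E | E. realization n d E}"
    and "{matching_number E | E. realization n d E} \<noteq> {}"
proof -
  have "{E. realization n d E} \<subseteq> Pow (Pow {1..n})"
    by (auto simp: realization_def simple_graph_def)
  then have "finite {E. realization n d E}"
    by (rule finite_subset) simp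
  then show "finite {matching_number E | E. realization n d E}"
    by simp
  show "{matching_number E | E. realization n d E} \<noteq> {}"
    using assms by (auto simp: graphic_def)
qed

end

theory Submission
  imports Defs
begin

text \<open>
  Deleting a matching \<open>M\<close> from a realization of \<open>d\<close> lowers the degrees of the \<open>2 |M|\<close> matched
  vertices by one. Conversely, if \<open>d\<close> and \<open>d - 1\<^sub>X\<close> are both graphic, Kundu's theorem gives a
  realization of \<open>d\<close> that contains one of \<open>d - 1\<^sub>X\<close>, and the remaining edges form a perfect
  matching of \<open>X\<close>. So some realization has a matching of size \<open>\<mu>\<close> iff \<open>d - 1\<^sub>X\<close> is graphic for
  some \<open>X\<close> of size \<open>2\<mu>\<close>. By the theorem of Erdos and Gallai this is a family of inequalities, and
  since those of \<open>d\<close> itself hold, all of them follow from (a) and (b) when \<open>X\<close> consists of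
  vertices of largest degree. Hence \<open>S\<close> is the set of all positive sizes of matchings.
\<close>

section \<open>Degrees and exchanges of edges\<close>

lemma degree_empty [simp]: "degree {} v = 0"
  by (simp add: degree_def)

lemma degree_Un_disjoint:
  assumes "finite E" "finite F" "E \<inter> F = {}"
  shows "degree (E \<union> F) v = degree E v + degree F v"
proof -
  have "{e \<in> E \<union> F. v \<in> e} = {e \<in> E. v \<in> e} \<union> {e \<in> F. v \<in> e}"
    by auto
  moreover have "card ({e \<in> E. v \<in> e} \<union> {e \<in> F. v \<in> e}) = card {e \<in> E. v \<in> e} + card {e \<in> F. v \<in> e}"
    by (rule card_Un_disjoint) (use assms in auto)
  ultimately show ?thesis
    by (simp add: degree_def)
qed

lemma degree_insert:
  assumes "finite E" "e \<notin> E"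
  shows "degree (insert e E) v = degree E v + of_bool (v \<in> e)"
proof -
  have "degree {e} v = of_bool (v \<in> e)"
    by (auto simp: degree_def Collect_conv_if)
  then show ?thesis
    using degree_Un_disjoint[of "{e}" E v] assms by simp
qed

text \<open>Additive form, so that trading \<open>R\<close> for \<open>A\<close> involves no
  truncated subtraction.\<close>

lemma degree_exchange:
  assumes "finite E" "R \<subseteq> E" "finite A" "A \<inter> E = {}"
  shows "degree (E - R \<union> A) v + degree R v = degree E v + degree A v"
proof -
  have "finite R"
    using assms finite_subset by blast
  then have "degree E v = degree (E - R) v + degree R v"
    using degree_Un_disjoint[of "E - R" R v] assms by (simp add: Un_absorb2 Int_commute)
  moreover have "degree (E - R \<union> A) v = degree (E - R) v + degree A v"
    using assms by (intro degree_Un_disjoint) auto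
  ultimately show ?thesis
    by simp
qed

lemma simple_graph_subset: "simple_graph V E \<Longrightarrow> F \<subseteq> E \<Longrightarrow> simple_graph V F"
  by (auto simp: simple_graph_def)

lemma simple_graph_Un: "simple_graph V E \<Longrightarrow> simple_graph V F \<Longrightarrow> simple_graph V (E \<union> F)"
  by (auto simp: simple_graph_def)

lemma simple_graph_edgeD:
  assumes "simple_graph V E" "{u, v} \<in> E"
  shows "u \<noteq> v" "u \<in> V" "v \<in> V"
  using assms by (force simp: simple_graph_def)+

lemma simple_graph_edge_cases:
  assumes "simple_graph V E" "e \<in> E"
  obtains u v where "e = {u, v}" "u \<noteq> v" "u \<in> V" "v \<in> V"
proof -
  have "card e = 2" "e \<subseteq> V"
    using assms by (auto simp: simple_graph_def)
  then show ?thesis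
    using that by (auto simp: card_2_iff)
qed

lemma degree_eq_card_nbrs:
  assumes "simple_graph V E"
  shows "degree E v = card {u. {u, v} \<in> E}"
proof -
  have "bij_betw (\<lambda>u. {u, v}) {u. {u, v} \<in> E} {e \<in> E. v \<in> e}"
    unfolding bij_betw_def
  proof
    show "inj_on (\<lambda>u. {u, v}) {u. {u, v} \<in> E}"
      by (auto simp: inj_on_def doubleton_eq_iff)
    show "(\<lambda>u. {u, v}) ` {u. {u, v} \<in> E} = {e \<in> E. v \<in> e}"
    proof
      show "{e \<in> E. v \<in> e} \<subseteq> (\<lambda>u. {u, v}) ` {u. {u, v} \<in> E}"
      proof
        fix e assume e: "e \<in> {e \<in> E. v \<in> e}"
        then obtain x y where xy: "e = {x, y}"
          using simple_graph_edge_cases[OF assms] by blast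
        then have "e = {y, v} \<or> e = {x, v}"
          using e by auto
        then show "e \<in> (\<lambda>u. {u, v}) ` {u. {u, v} \<in> E}"
          using e by auto
      qed
    qed auto
  qed
  then show ?thesis
    by (simp add: degree_def bij_betw_same_card)
qed

lemma finite_nbrs:
  assumes "simple_graph V E"
  shows "finite {u. {u, v} \<in> E}"
proof (rule finite_subset)
  show "{u. {u, v} \<in> E} \<subseteq> V"
    using simple_graph_edgeD[OF assms] by blast
  show "finite V"
    using assms by (simp add: simple_graph_def)
qed

lemma card_eq_sum_of_bool: "finite A \<Longrightarrow> card {x \<in> A. P x} = (\<Sum>x\<in>A. of_bool (P x))"
  by (simp add: Int_def of_bool_def sum.If_cases)

lemma sum_degree:
  assumes "simple_graph V E"
  shows "(\<Sum>v\<in>V. degree E v) = 2 * card E"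
proof -
  have fin: "finite V" "finite E"
    using assms simple_graph_finite_edges[OF assms] by (auto simp: simple_graph_def)
  have "(\<Sum>v\<in>V. degree E v) = (\<Sum>v\<in>V. \<Sum>e\<in>E. of_bool (v \<in> e))"
    by (simp only: degree_def card_eq_sum_of_bool[OF fin(2)])
  also have "\<dots> = (\<Sum>e\<in>E. \<Sum>v\<in>V. of_bool (v \<in> e))"
    by (rule sum.swap)
  also have "\<dots> = (\<Sum>e\<in>E. card e)"
  proof (rule sum.cong)
    fix e assume "e \<in> E"
    then have "{v \<in> V. v \<in> e} = e"
      using assms by (auto simp: simple_graph_def)
    then show "(\<Sum>v\<in>V. of_bool (v \<in> e)) = card e"
      by (metis card_eq_sum_of_bool[OF fin(1), of "\<lambda>v. v \<in> e"])
  qed simp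
  also have "\<dots> = 2 * card E"
    using assms by (simp add: simple_graph_def)
  finally show ?thesis .
qed

text \<open>Edges leaving \<open>K\<close> are counted from their outer ends. The Erdos-Gallai
  inequality bounds the two sums separately.\<close>

lemma sum_degree_subset:
  assumes G: "simple_graph V E" and K: "K \<subseteq> V"
  shows "(\<Sum>v\<in>K. degree E v)
    = (\<Sum>v\<in>K. card {u \<in> K. {u, v} \<in> E}) + (\<Sum>w\<in>V - K. card {u \<in> K. {u, w} \<in> E})"
proof -
  have fin: "finite V" "finite K"
    using G K finite_subset by (auto simp: simple_graph_def)
  have "degree E v = card {u \<in> K. {u, v} \<in> E} + card {w \<in> V - K. {w, v} \<in> E}" for v
  proof -
    have "{u. {u, v} \<in> E} = {u \<in> K. {u, v} \<in> E} \<union> {w \<in> V - K. {w, v} \<in> E}"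
      using simple_graph_edgeD(2)[OF G, of _ v] K by auto
    moreover have "card ({u \<in> K. {u, v} \<in> E} \<union> {w \<in> V - K. {w, v} \<in> E})
        = card {u \<in> K. {u, v} \<in> E} + card {w \<in> V - K. {w, v} \<in> E}"
      by (rule card_Un_disjoint) (use fin in auto)
    ultimately show ?thesis
      by (simp only: degree_eq_card_nbrs[OF G])
  qed
  moreover have "(\<Sum>v\<in>K. card {w \<in> V - K. {w, v} \<in> E}) = (\<Sum>w\<in>V - K. card {u \<in> K. {u, w} \<in> E})"
  proof -
    have "(\<Sum>v\<in>K. card {w \<in> V - K. {w, v} \<in> E}) = (\<Sum>v\<in>K. \<Sum>w\<in>V - K. of_bool ({w, v} \<in> E))"
      by (intro sum.cong refl card_eq_sum_of_bool) (use fin in auto)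
    also have "\<dots> = (\<Sum>w\<in>V - K. \<Sum>v\<in>K. of_bool ({w, v} \<in> E))"
      by (rule sum.swap)
    also have "\<dots> = (\<Sum>w\<in>V - K. card {u \<in> K. {u, w} \<in> E})"
      by (intro sum.cong refl) (simp add: card_eq_sum_of_bool[OF fin(2)] insert_commute)
    finally show ?thesis .
  qed
  ultimately show ?thesis
    by (simp add: sum.distrib)
qed

text \<open>Each of \<open>x\<close>, \<open>w\<close>, \<open>y\<close>, \<open>z\<close> loses one
  edge and gains one. The cases \<open>x = z\<close> and \<open>w = y\<close> are impossible, as an
  absent edge would coincide with a present one.\<close>

lemma two_switch:
  assumes G: "simple_graph V E"
    and "{x, w} \<in> E" "{y, z} \<in> E" "{x, y} \<notin> E" "{w, z} \<notin> E" "x \<noteq> y" "w \<noteq> z"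
  defines "F \<equiv> E - {{x, w}, {y, z}} \<union> {{x, y}, {w, z}}"
  shows "simple_graph V F" "degree F v = degree E v"
proof -
  have neq: "x \<noteq> w" "y \<noteq> z" "x \<noteq> z" "w \<noteq> y"
    using simple_graph_edgeD[OF G] assms by (auto simp: insert_commute)
  have "simple_graph V {{x, y}, {w, z}}"
    using simple_graph_edgeD[OF G] assms by (auto simp: simple_graph_def)
  then show "simple_graph V F"
    unfolding F_def using simple_graph_subset[OF G] by (intro simple_graph_Un) auto
  have "degree F v + degree {{x, w}, {y, z}} v = degree E v + degree {{x, y}, {w, z}} v"
    unfolding F_def
    by (rule degree_exchange) (use assms simple_graph_finite_edges[OF G] in auto)
  then show "degree F v = degree E v"
    using neq assms(6,7) by (cases "v = x"; cases "v = y"; cases "v = w"; cases "v = z")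
      (auto simp: degree_insert doubleton_eq_iff)
qed

section \<open>Kundu's theorem\<close>

text \<open>
  Kundu's theorem for differences in \<open>{0, 1}\<close>. In a pair \<open>(F, F')\<close> with \<open>F' - F\<close> smallest, call
  the edges of \<open>F - F'\<close> red and those of \<open>F' - F\<close> blue. No 2-switch improves the pair, so for a
  blue edge \<open>xy\<close> and red edges \<open>xw\<close>, \<open>yz\<close> the edge \<open>wz\<close> is red, which makes the red degree of \<open>w\<close>
  exceed that of \<open>y\<close>. Going along blue and red edges in turn, red degrees would grow forever.
\<close>

lemma nested_realizations:
  assumes "simple_graph V E" "simple_graph V E'"
    and "\<And>v. v \<in> V \<Longrightarrow> degree E' v \<le> degree E v \<and> degree E v \<le> degree E' v + 1"
  obtains F F' where "simple_graph V F" "F' \<subseteq> F"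
    "\<And>v. v \<in> V \<Longrightarrow> degree F v = degree E v" "\<And>v. v \<in> V \<Longrightarrow> degree F' v = degree E' v"
proof -
  define P where "P = (\<lambda>(F, F'). simple_graph V F \<and> simple_graph V F' \<and>
    (\<forall>v\<in>V. degree F v = degree E v) \<and> (\<forall>v\<in>V. degree F' v = degree E' v))"
  have "P (E, E')"
    using assms by (simp add: P_def)
  from ex_has_least_nat[of P, OF this, of "\<lambda>(F, F'). card (F' - F)"]
  obtain F F' where "P (F, F')"
    and least: "\<And>A A'. P (A, A') \<Longrightarrow> card (F' - F) \<le> card (A' - A)"
    by auto
  then have F: "simple_graph V F" and F': "simple_graph V F'"
    and deg: "\<And>v. v \<in> V \<Longrightarrow> degree F v = degree E v" "\<And>v. v \<in> V \<Longrightarrow> degree F' v = degree E' v"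
    by (auto simp: P_def)
  have fin: "finite F" "finite F'" "finite V"
    using simple_graph_finite_edges F F' by (auto simp: simple_graph_def)
  have R: "simple_graph V (F - F')" and B: "simple_graph V (F' - F)"
    using F F' by (auto intro: simple_graph_subset)
  define r b where "r v = degree (F - F') v" and "b v = degree (F' - F) v" for v
  have rb: "b v \<le> r v" "r v \<le> b v + 1" if "v \<in> V" for v
  proof -
    have "degree (F - F' \<union> F \<inter> F') v = r v + degree (F \<inter> F') v"
      unfolding r_def by (rule degree_Un_disjoint) (use fin in auto)
    then have 1: "degree F v = r v + degree (F \<inter> F') v"
      by (simp only: Un_Diff_Int)
    have "degree (F' - F \<union> F' \<inter> F) v = b v + degree (F' \<inter> F) v"
      unfolding b_def by (rule degree_Un_disjoint) (use fin in auto)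
    then have 2: "degree F' v = b v + degree (F \<inter> F') v"
      by (simp only: Un_Diff_Int) (simp only: Int_commute)
    from 1 2 have "r v + degree E' v = b v + degree E v"
      using deg[OF that] by simp
    then show "b v \<le> r v" "r v \<le> b v + 1"
      using assms(3)[OF that] deg[OF that] by auto
  qed
  have red: "{w, z} \<in> F - F'"
    if "{x, y} \<in> F' - F" "{x, w} \<in> F - F'" "{y, z} \<in> F - F'" "w \<noteq> z" for x y w z
  proof (rule ccontr)
    assume no: "{w, z} \<notin> F - F'"
    have "x \<noteq> y" "x \<noteq> w" "y \<noteq> z"
      using that simple_graph_edgeD(1)[OF F, of x w] simple_graph_edgeD(1)[OF F, of y z]
        simple_graph_edgeD(1)[OF F', of x y] by auto
    show False
    \<comment> \<open>If \<open>wz\<close> is missing from \<open>F\<close>, a switch there adds the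
      blue edge \<open>xy\<close> to \<open>F\<close>. Otherwise \<open>wz\<close>, not being red,
      lies in both graphs, and a switch in \<open>F'\<close> removes \<open>xy\<close>. Neither
      creates a blue edge.\<close>
    proof (cases "{w, z} \<in> F")
      case False
      define A where "A = F - {{x, w}, {y, z}} \<union> {{x, y}, {w, z}}"
      have "P (A, F')"
        using two_switch[OF F, of x w y z] that False \<open>x \<noteq> y\<close> F' deg by (simp add: P_def A_def)
      moreover have "card (F' - A) < card (F' - F)"
        by (rule psubset_card_mono) (use that fin in \<open>auto simp: A_def\<close>)
      ultimately show False
        using least by force
    next
      case True
      define A where "A = F' - {{x, y}, {w, z}} \<union> {{x, w}, {y, z}}"
      have "P (F, A)"
        using two_switch[OF F', of x y w z] that True no \<open>x \<noteq> w\<close> \<open>y \<noteq> z\<close> F deg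
        by (simp add: P_def A_def)
      moreover have "card (A - F) < card (F' - F)"
        by (rule psubset_card_mono) (use that fin in \<open>auto simp: A_def\<close>)
      ultimately show False
        using least by force
    qed
  qed
  have grow: "r y < r w" if "{x, y} \<in> F' - F" "{x, w} \<in> F - F'" for x y w
  proof -
    define N where "N = {u. {u, y} \<in> F - F'}"
    \<comment> \<open>By \<open>red\<close>, \<open>w\<close> has as red neighbours \<open>x\<close>
      and all red neighbours of \<open>y\<close> other than \<open>w\<close> itself; if
      \<open>w\<close> is one of these, \<open>y\<close> takes its place. So \<open>N'\<close> has
      one element more than \<open>N\<close>.\<close>
    define N' where "N' = insert x (N - {w}) \<union> (if w \<in> N then {y} else {})"
    have "finite N"
      unfolding N_def by (rule finite_nbrs[OF R])
    have "x \<notin> N" "y \<notin> N" "x \<noteq> y"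
      using that simple_graph_edgeD(1)[OF R, of y y] simple_graph_edgeD(1)[OF B, of x y]
      by (auto simp: N_def)
    then have "card N' = Suc (card N)"
      using \<open>finite N\<close> card_Suc_Diff1[of N w] by (cases "w \<in> N") (simp_all add: N'_def)
    moreover have "N' \<subseteq> {u. {u, w} \<in> F - F'}"
      using red[OF that] that(2) by (auto simp: N'_def N_def insert_commute split: if_splits)
    then have "card N' \<le> r w"
      unfolding r_def degree_eq_card_nbrs[OF R] by (rule card_mono[OF finite_nbrs[OF R]])
    ultimately show ?thesis
      by (simp add: r_def degree_eq_card_nbrs[OF R] N_def)
  qed
  have nbr: "\<exists>u\<in>V. {u, v} \<in> H" if "simple_graph V H" "degree H v > 0" for H v
  proof -
    have "{u. {u, v} \<in> H} \<noteq> {}"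
      using that degree_eq_card_nbrs[OF that(1), of v] by (metis card.empty less_numeral_extra(3))
    then show ?thesis
      using simple_graph_edgeD(2)[OF that(1)] by blast
  qed
  have bpos: "b u > 0" if "{u, v} \<in> F' - F" for u v
  proof -
    have "v \<in> {x. {x, u} \<in> F' - F}"
      using that by (auto simp: insert_commute)
    then show ?thesis
      unfolding b_def degree_eq_card_nbrs[OF B] card_gt_0_iff using finite_nbrs[OF B] by blast+
  qed
  have "F' \<subseteq> F"
  proof (rule ccontr)
    assume "\<not> F' \<subseteq> F"
    then obtain e where e: "e \<in> F' - F"
      by blast
    then obtain x y where "e = {x, y}" "x \<in> V"
      using simple_graph_edge_cases[OF B] by metis
    with e have W: "{v \<in> V. b v > 0} \<noteq> {}" (is "?W \<noteq> _")
      using bpos[of x y] by blast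
    \<comment> \<open>Among the vertices on blue edges, \<open>v\<close> has the largest red degree;
      a blue step to \<open>p\<close> and a red step to \<open>q\<close> will exceed it.\<close>
    have "Max (r ` ?W) \<in> r ` ?W"
      using W fin(3) by (intro Max_in) auto
    then obtain v where v: "v \<in> V" "b v > 0" and "Max (r ` ?W) = r v"
      by blast
    moreover have "r u \<le> Max (r ` ?W)" if "u \<in> V" "b u > 0" for u
      using that fin(3) by (intro Max_ge) auto
    ultimately have vmax: "r u \<le> r v" if "u \<in> V" "b u > 0" for u
      using that by metis
    obtain p where p: "p \<in> V" "{p, v} \<in> F' - F"
      using nbr[OF B] v by (auto simp: b_def)
    have "r p > 0"
      using bpos[OF p(2)] rb(1)[OF p(1)] by simp
    then obtain q where q: "q \<in> V" "{q, p} \<in> F - F'"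
      using nbr[OF R] by (auto simp: r_def)
    have "r v < r q"
      using grow[of p v q] p q by (simp add: insert_commute)
    \<comment> \<open>Since \<open>r v \<ge> b v \<ge> 1\<close>, the red degree of \<open>q\<close>
      is at least 2, and its blue degree is at most one less.\<close>
    moreover have "b q > 0"
      using \<open>r v < r q\<close> rb[OF v(1)] rb[OF q(1)] v(2) by linarith
    ultimately show False
      using vmax[OF q(1)] by simp
  qed
  with F deg that show ?thesis
    by blast
qed

section \<open>The theorem of Erdos and Gallai\<close>

lemma degree_singleton: "degree {e} v = of_bool (v \<in> e)"
  by (simp add: degree_insert)

lemma degree_doubleton: "e \<noteq> e' \<Longrightarrow> degree {e, e'} v = of_bool (v \<in> e) + of_bool (v \<in> e')"
  by (simp add: degree_insert)

text \<open>Right side minus left side of the Erdos-Gallai inequality, for any vertex set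
  \<open>K\<close>: the necessity of (b) uses sets other than initial segments.\<close>

definition eg_slack :: "'a set \<Rightarrow> ('a \<Rightarrow> nat) \<Rightarrow> 'a set \<Rightarrow> int" where
  "eg_slack V f K = int (card K) * (int (card K) - 1)
     + (\<Sum>i\<in>V - K. min (int (f i)) (int (card K))) - (\<Sum>i\<in>K. int (f i))"

text \<open>A vertex of \<open>K\<close> has at most \<open>card K - 1\<close> neighbours in
  \<open>K\<close>, and a vertex outside has at most the minimum of its degree and
  \<open>card K\<close>.\<close>

lemma eg_slack_degree_nonneg:
  assumes G: "simple_graph V E" and K: "K \<subseteq> V"
  shows "0 \<le> eg_slack V (degree E) K"
proof -
  have fin: "finite V" "finite K"
    using G K finite_subset by (auto simp: simple_graph_def)
  have "card {u \<in> K. {u, v} \<in> E} \<le> card K - 1" if "v \<in> K" for v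
  proof -
    have "{u \<in> K. {u, v} \<in> E} \<subseteq> K - {v}"
      using simple_graph_edgeD(1)[OF G] by blast
    then show ?thesis
      using card_mono[of "K - {v}"] fin that by fastforce
  qed
  then have "(\<Sum>v\<in>K. card {u \<in> K. {u, v} \<in> E}) \<le> card K * (card K - 1)"
    using sum_bounded_above[of K "\<lambda>v. card {u \<in> K. {u, v} \<in> E}" "card K - 1"] by simp
  then have "int (\<Sum>v\<in>K. card {u \<in> K. {u, v} \<in> E}) \<le> int (card K * (card K - 1))"
    by (simp only: of_nat_le_iff)
  also have "\<dots> = int (card K) * (int (card K) - 1)"
    by (cases "card K") (simp_all add: algebra_simps)
  finally have "int (\<Sum>v\<in>K. card {u \<in> K. {u, v} \<in> E}) \<le> int (card K) * (int (card K) - 1)" .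
  moreover have "int (\<Sum>w\<in>V - K. card {u \<in> K. {u, w} \<in> E})
      \<le> (\<Sum>w\<in>V - K. min (int (degree E w)) (int (card K)))"
    unfolding of_nat_sum
  proof (rule sum_mono)
    fix w
    have "card {u \<in> K. {u, w} \<in> E} \<le> degree E w"
      unfolding degree_eq_card_nbrs[OF G] by (rule card_mono[OF finite_nbrs[OF G]]) auto
    moreover have "card {u \<in> K. {u, w} \<in> E} \<le> card K"
      by (rule card_mono) (use fin in auto)
    ultimately show "int (card {u \<in> K. {u, w} \<in> E}) \<le> min (int (degree E w)) (int (card K))"
      by simp
  qed
  moreover have "(\<Sum>v\<in>K. int (degree E v)) = int (\<Sum>v\<in>K. card {u \<in> K. {u, v} \<in> E})
      + int (\<Sum>w\<in>V - K. card {u \<in> K. {u, w} \<in> E})"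
    using arg_cong[OF sum_degree_subset[OF G K], of int] by simp
  ultimately show ?thesis
    by (simp add: eg_slack_def)
qed

text \<open>Equality case of the same count: \<open>E\<close> attains both bounds, so the slack of
  \<open>f\<close> is minus the total amount by which degrees in \<open>K\<close> fall short of
  \<open>f\<close>.\<close>

lemma eg_slack_clique:
  assumes G: "simple_graph V E" and K: "K \<subseteq> V"
    and clique: "\<And>u v. u \<in> K \<Longrightarrow> v \<in> K \<Longrightarrow> u \<noteq> v \<Longrightarrow> {u, v} \<in> E"
    and indep: "\<And>u v. {u, v} \<in> E \<Longrightarrow> u \<in> K \<or> v \<in> K"
    and sat: "\<And>w. w \<in> V - K \<Longrightarrow> degree E w = min (f w) (card K)"
  shows "eg_slack V f K = (\<Sum>v\<in>K. int (degree E v) - int (f v))"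
proof -
  have fin: "finite V" "finite K"
    using G K finite_subset by (auto simp: simple_graph_def)
  have "card {u \<in> K. {u, v} \<in> E} = card K - 1" if "v \<in> K" for v
  proof -
    have "{u \<in> K. {u, v} \<in> E} = K - {v}"
      using simple_graph_edgeD(1)[OF G, of v v] clique that by auto
    then show ?thesis
      using that fin by simp
  qed
  then have "int (\<Sum>v\<in>K. card {u \<in> K. {u, v} \<in> E}) = int (card K) * (int (card K) - 1)"
    by (cases "card K") (simp_all add: algebra_simps)
  moreover have "int (\<Sum>w\<in>V - K. card {u \<in> K. {u, w} \<in> E})
      = (\<Sum>w\<in>V - K. min (int (f w)) (int (card K)))"
    unfolding of_nat_sum
  proof (rule sum.cong)
    fix w assume w: "w \<in> V - K"
    then have "{u \<in> K. {u, w} \<in> E} = {u. {u, w} \<in> E}"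
      using indep by blast
    then have "card {u \<in> K. {u, w} \<in> E} = min (f w) (card K)"
      using sat[OF w] by (simp only: degree_eq_card_nbrs[OF G])
    then show "int (card {u \<in> K. {u, w} \<in> E}) = min (int (f w)) (int (card K))"
      by simp
  qed simp
  moreover have "(\<Sum>v\<in>K. int (degree E v)) = int (\<Sum>v\<in>K. card {u \<in> K. {u, v} \<in> E})
      + int (\<Sum>w\<in>V - K. card {u \<in> K. {u, w} \<in> E})"
    using arg_cong[OF sum_degree_subset[OF G K], of int] by simp
  ultimately show ?thesis
    by (simp add: eg_slack_def sum_subtractf)
qed

text \<open>Neighbourhoods are compared with \<open>v\<close> and \<open>w\<close> removed, since an
  edge \<open>vw\<close> counts for both.\<close>

lemma ex_private_neighbour:
  assumes G: "simple_graph V E" and less: "degree E v < degree E w"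
  obtains u where "{u, w} \<in> E" "{u, v} \<notin> E" "u \<noteq> v"
proof (rule ccontr)
  assume "\<not> thesis"
  then have sub: "{u. {u, w} \<in> E} - {v} \<subseteq> {u. {u, v} \<in> E} - {w}"
    using that simple_graph_edgeD(1)[OF G, of w w] by blast
  have "card ({u. {u, w} \<in> E} - {v}) \<le> card ({u. {u, v} \<in> E} - {w})"
    using sub finite_nbrs[OF G] by (intro card_mono) auto
  moreover have "v \<in> {u. {u, w} \<in> E} \<longleftrightarrow> w \<in> {u. {u, v} \<in> E}"
    by (simp add: insert_commute)
  ultimately have "card {u. {u, w} \<in> E} \<le> card {u. {u, v} \<in> E}"
    using card_Suc_Diff1[OF finite_nbrs[OF G], of v w] card_Suc_Diff1[OF finite_nbrs[OF G], of w v]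
    by (cases "{v, w} \<in> E") (auto simp: insert_commute)
  then show False
    using less by (simp add: degree_eq_card_nbrs[OF G])
qed

text \<open>\<open>r\<close> is the vertex being completed. The last clause makes the vertices after
  \<open>r\<close> independent, which keeps their degrees at most \<open>r\<close>.\<close>

definition partial_realization :: "nat \<Rightarrow> (nat \<Rightarrow> nat) \<Rightarrow> nat \<Rightarrow> nat set set \<Rightarrow> bool" where
  "partial_realization n f r E \<longleftrightarrow> simple_graph {1..n} E \<and> (\<forall>i\<in>{1..n}. degree E i \<le> f i) \<and>
     (\<forall>i\<in>{1..<r}. degree E i = f i) \<and> (\<forall>e\<in>E. \<exists>x\<in>e. x \<le> r)"

text \<open>
  The argument of Tripathi, Venugopalan and West: while the vertices after \<open>r\<close> stay independent
  and \<open>r\<close> lacks edges, some exchange raises its degree, unless \<open>{1..r}\<close> is a clique and the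
  degrees outside it are as large as possible, and then the inequality for \<open>{1..r}\<close> fails.
\<close>

lemma partial_realization_augment:
  assumes anti: "antimono_on {1..n} f" and even: "even (\<Sum>i\<in>{1..n}. f i)"
    and slack: "0 \<le> eg_slack {1..n} f {1..r}" and r: "r \<in> {1..n}"
    and E: "partial_realization n f r E" and less: "degree E r < f r"
  obtains F where "partial_realization n f r F" "degree E r < degree F r"
proof (rule ccontr)
  assume "\<not> thesis"
  then have no: "\<And>F. partial_realization n f r F \<Longrightarrow> \<not> degree E r < degree F r"
    using that by blast
  have G: "simple_graph {1..n} E" and le: "\<And>i. i \<in> {1..n} \<Longrightarrow> degree E i \<le> f i"
    and sat: "\<And>i. i \<in> {1..<r} \<Longrightarrow> degree E i = f i" and cover: "\<And>e. e \<in> E \<Longrightarrow> \<exists>x\<in>e. x \<le> r"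
    using E by (auto simp: partial_realization_def)
  note finE = simple_graph_finite_edges[OF G]
  \<comment> \<open>Common form of the exchanges below: the degree of \<open>r\<close> rises, those
    before \<open>r\<close> stay, and none exceeds \<open>f\<close>.\<close>
  have improve: False
    if R: "R \<subseteq> E" and A: "simple_graph {1..n} A" "A \<inter> E = {}" "\<forall>e\<in>A. \<exists>x\<in>e. x \<le> r"
      and deg: "\<And>v. v \<in> {1..n} \<Longrightarrow> degree E v + degree A v \<le> f v + degree R v"
        "\<And>v. v \<in> {1..<r} \<Longrightarrow> degree A v = degree R v" "degree R r < degree A r" for R A
  proof -
    have ex: "degree (E - R \<union> A) v + degree R v = degree E v + degree A v" for v
      by (rule degree_exchange[OF finE R simple_graph_finite_edges[OF A(1)] A(2)])
    have "simple_graph {1..n} (E - R \<union> A)"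
      using simple_graph_subset[OF G] A(1) by (intro simple_graph_Un) auto
    moreover have "degree (E - R \<union> A) v \<le> f v" if "v \<in> {1..n}" for v
      using ex[of v] deg(1)[OF that] by linarith
    moreover have "degree (E - R \<union> A) v = f v" if "v \<in> {1..<r}" for v
      using ex[of v] deg(2)[OF that] sat[OF that] by linarith
    moreover have "\<forall>e\<in>E - R \<union> A. \<exists>x\<in>e. x \<le> r"
      using A(3) cover by blast
    ultimately have "partial_realization n f r (E - R \<union> A)"
      unfolding partial_realization_def by blast
    from no[OF this] show False
      using ex[of r] deg(3) by linarith
  qed
  \<comment> \<open>Vertices before \<open>r\<close> have degree at least \<open>f r\<close>, more
    than \<open>r\<close> has now. A private neighbour \<open>u\<close> of \<open>i\<close> lets
    \<open>ui\<close> be replaced by \<open>ur\<close>.\<close>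
  have priv: "\<exists>u. {u, i} \<in> E \<and> {u, r} \<notin> E \<and> u \<noteq> r \<and> u \<noteq> i \<and> u \<in> {1..n}" if "i \<in> {1..<r}" for i
  proof -
    have "f r \<le> f i"
      using that r by (intro monotone_onD[OF anti]) auto
    then have "degree E r < degree E i"
      using sat[OF that] less by simp
    then show ?thesis
      using ex_private_neighbour[OF G, of r i] simple_graph_edgeD[OF G] by metis
  qed
  have edge: "simple_graph {1..n} {{u, v}}" if "u \<noteq> v" "u \<in> {1..n}" "v \<in> {1..n}" for u v
    using that by (simp add: simple_graph_def)
  have edges: "simple_graph {1..n} {{u, v}, {x, y}}"
    if "u \<noteq> v" "u \<in> {1..n}" "v \<in> {1..n}" "x \<noteq> y" "x \<in> {1..n}" "y \<in> {1..n}" for u v x y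
    using that by (simp add: simple_graph_def)
  have adj_deficient: "{k, r} \<in> E" if "k \<in> {r<..n}" "degree E k < f k" for k
  proof (rule ccontr)
    assume "{k, r} \<notin> E"
    show False
    proof (rule improve[of "{}" "{{k, r}}"])
      show "degree E v + degree {{k, r}} v \<le> f v + degree {} v" if "v \<in> {1..n}" for v
        using le[OF that] less \<open>degree E k < f k\<close> by (auto simp: degree_singleton)
    qed (use that r \<open>{k, r} \<notin> E\<close> edge[of k r] in \<open>auto simp: degree_singleton\<close>)
  qed
  have adj_less: "{i, r} \<in> E" if i: "i \<in> {1..<r}" for i
  proof (rule ccontr)
    assume ir: "{i, r} \<notin> E"
    obtain u where u: "{u, i} \<in> E" "{u, r} \<notin> E" "u \<noteq> r" "u \<noteq> i" "u \<in> {1..n}"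
      using priv[OF i] by blast
    have ne: "{u, r} \<noteq> {i, r}"
      using u by (auto simp: doubleton_eq_iff)
    show False
    \<comment> \<open>Trading \<open>ui\<close> for \<open>ur\<close> and \<open>ir\<close> raises
      \<open>r\<close> by two. If \<open>r\<close> lacks only one edge, parity of the degree sum
      yields another deficient vertex \<open>k\<close> after \<open>r\<close>; it is adjacent to
      \<open>r\<close>, and giving up \<open>kr\<close> reduces the gain to one.\<close>
    proof (cases "degree E r + 2 \<le> f r")
      case True
      show False
      proof (rule improve[of "{{u, i}}" "{{u, r}, {i, r}}"])
        show "degree E v + degree {{u, r}, {i, r}} v \<le> f v + degree {{u, i}} v" if "v \<in> {1..n}" for v
          using le[OF that] True u i by (auto simp: degree_singleton degree_doubleton[OF ne])
      qed (use u i r ir edges[of u r i r] in \<open>auto simp: degree_singleton degree_doubleton[OF ne]\<close>)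
    next
      case False
      have "\<exists>k\<in>{r<..n}. degree E k < f k"
      proof (rule ccontr)
        assume "\<not> ?thesis"
        then have "f k \<le> degree E k" if "k \<in> {r<..n}" for k
          using that by (auto simp: not_less)
        then have "f k = degree E k + of_bool (k = r)" if "k \<in> {1..n}" for k
          using that le[OF that] sat[of k] False less by (cases k r rule: linorder_cases) force+
        then have "(\<Sum>k\<in>{1..n}. f k) = (\<Sum>k\<in>{1..n}. degree E k) + (\<Sum>k\<in>{1..n}. of_bool (k = r))"
          by (simp add: sum.distrib)
        moreover have "(\<Sum>k\<in>{1..n}. of_bool (k = r)) = (1::nat)"
          using r by (simp add: of_bool_def)
        ultimately show False
          using even sum_degree[OF G] by simp
      qed
      then obtain k where k: "k \<in> {r<..n}" "{k, r} \<in> E" "degree E k < f k"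
        using adj_deficient by blast
      have "k \<noteq> u" "k \<noteq> i" "r \<noteq> i"
        using k u i by auto
      then have ne': "{k, r} \<noteq> {u, i}"
        by (auto simp: doubleton_eq_iff)
      show False
      proof (rule improve[of "{{k, r}, {u, i}}" "{{u, r}, {i, r}}"])
        show "degree E v + degree {{u, r}, {i, r}} v \<le> f v + degree {{k, r}, {u, i}} v"
          if "v \<in> {1..n}" for v
          using le[OF that] less u i \<open>r \<noteq> i\<close>
          by (auto simp: degree_doubleton[OF ne] degree_doubleton[OF ne'])
      qed (use u i k r ir edges[of u r i r] \<open>k \<noteq> u\<close> in
          \<open>auto simp: degree_doubleton[OF ne] degree_doubleton[OF ne']\<close>)
    qed
  qed
  \<comment> \<open>Otherwise \<open>k\<close> is adjacent to \<open>r\<close> but not to some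
    \<open>i < r\<close>, and \<open>ui\<close> can be traded for \<open>ur\<close> and
    \<open>ik\<close>.\<close>
  have outer: "degree E k = min (f k) r" if k: "k \<in> {r<..n}" for k
  proof (rule ccontr)
    have "{u. {u, k} \<in> E} \<subseteq> {1..r}"
      using cover k simple_graph_edgeD[OF G] by fastforce
    then have "degree E k \<le> r"
      unfolding degree_eq_card_nbrs[OF G] using card_mono[of "{1..r}"] by fastforce
    moreover assume "degree E k \<noteq> min (f k) r"
    ultimately have low: "degree E k < f k" "degree E k < r"
      using le[of k] k by (auto simp: min_def split: if_splits)
    have kr: "{k, r} \<in> E"
      by (rule adj_deficient[OF k low(1)])
    have "\<exists>i\<in>{1..<r}. {i, k} \<notin> E"
    proof (rule ccontr)
      assume "\<not> ?thesis"
      then have "{i, k} \<in> E" if "i \<in> {1..r}" for i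
        using that kr by (cases "i = r") (auto simp: insert_commute)
      then have "{1..r} \<subseteq> {u. {u, k} \<in> E}"
        by blast
      from card_mono[OF finite_nbrs[OF G] this] show False
        using low(2) by (simp add: degree_eq_card_nbrs[OF G])
    qed
    then obtain i where i: "i \<in> {1..<r}" "{i, k} \<notin> E"
      by blast
    obtain u where u: "{u, i} \<in> E" "{u, r} \<notin> E" "u \<noteq> r" "u \<noteq> i" "u \<in> {1..n}"
      using priv[OF i(1)] by blast
    have "u \<noteq> k"
      using u kr by auto
    have ne: "{u, r} \<noteq> {i, k}"
      using u i by (auto simp: doubleton_eq_iff)
    show False
    proof (rule improve[of "{{u, i}}" "{{u, r}, {i, k}}"])
      show "degree E v + degree {{u, r}, {i, k}} v \<le> f v + degree {{u, i}} v" if "v \<in> {1..n}" for v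
        using le[OF that] less low u i k by (auto simp: degree_singleton degree_doubleton[OF ne])
    qed (use u i k r edges[of u r i k] \<open>u \<noteq> k\<close> in
        \<open>auto simp: degree_singleton degree_doubleton[OF ne]\<close>)
  qed
  \<comment> \<open>Private neighbours lie after \<open>r\<close>, so \<open>w\<close> may lose an
    edge: \<open>ui\<close> and \<open>wj\<close> are traded for \<open>ij\<close> and
    \<open>ur\<close>, even if \<open>u = w\<close>.\<close>
  have inner: "{i, j} \<in> E" if i: "i \<in> {1..<r}" and j: "j \<in> {1..<r}" and "i \<noteq> j" for i j
  proof (rule ccontr)
    assume ij: "{i, j} \<notin> E"
    obtain u where u: "{u, i} \<in> E" "{u, r} \<notin> E" "u \<noteq> r" "u \<noteq> i" "u \<in> {1..n}"
      using priv[OF i] by blast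
    obtain w where w: "{w, j} \<in> E" "{w, r} \<notin> E" "w \<noteq> r" "w \<noteq> j" "w \<in> {1..n}"
      using priv[OF j] by blast
    have "r < u" "r < w"
      using adj_less[of u] adj_less[of w] u w by force+
    then have ne: "{i, j} \<noteq> {u, r}" "{u, i} \<noteq> {w, j}"
      using i j \<open>i \<noteq> j\<close> by (auto simp: doubleton_eq_iff)
    show False
    proof (rule improve[of "{{u, i}, {w, j}}" "{{i, j}, {u, r}}"])
      show "degree E v + degree {{i, j}, {u, r}} v \<le> f v + degree {{u, i}, {w, j}} v"
        if "v \<in> {1..n}" for v
        using le[OF that] less u w i j \<open>i \<noteq> j\<close>
        by (auto simp: degree_doubleton[OF ne(1)] degree_doubleton[OF ne(2)])
    qed (use u w i j r ij \<open>i \<noteq> j\<close> \<open>r < u\<close> \<open>r < w\<close> edges[of i j u r] in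
        \<open>auto simp: degree_doubleton[OF ne(1)] degree_doubleton[OF ne(2)]\<close>)
  qed
  have "eg_slack {1..n} f {1..r} = (\<Sum>v\<in>{1..r}. int (degree E v) - int (f v))"
  proof (rule eg_slack_clique[OF G])
    show "{u, v} \<in> E" if "u \<in> {1..r}" "v \<in> {1..r}" "u \<noteq> v" for u v
    proof -
      have "u \<in> {1..<r} \<or> u = r" "v \<in> {1..<r} \<or> v = r"
        using that by auto
      then show ?thesis
        using inner adj_less that(3) by (metis insert_commute)
    qed
    show "u \<in> {1..r} \<or> v \<in> {1..r}" if "{u, v} \<in> E" for u v
      using cover[OF that] simple_graph_edgeD(2,3)[OF G that] by auto
    show "degree E w = min (f w) (card {1..r})" if "w \<in> {1..n} - {1..r}" for w
      using outer[of w] that by auto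
  qed (use r in auto)
  also have "\<dots> < (\<Sum>v\<in>{1..r}. 0)"
  proof (rule sum_strict_mono_ex1)
    show "\<forall>v\<in>{1..r}. int (degree E v) - int (f v) \<le> 0"
      using le r by auto
    show "\<exists>v\<in>{1..r}. int (degree E v) - int (f v) < 0"
      using less r by force
  qed simp
  finally show False
    using slack by simp
qed

text \<open>From the empty graph at stage 1, augmentation saturates one vertex after another, with
  the deficit of \<open>r\<close> as measure; stage \<open>n + 1\<close> is a realization.\<close>

theorem erdos_gallai:
  assumes anti: "antimono_on {1..n} f" and even: "even (\<Sum>i\<in>{1..n}. f i)"
    and slack: "\<And>r. r \<in> {1..n} \<Longrightarrow> 0 \<le> eg_slack {1..n} f {1..r}"
  shows "graphic n f"
proof -
  have saturate: "\<exists>F. partial_realization n f (Suc r) F"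
    if r: "r \<in> {1..n}" and E: "partial_realization n f r E" for r E
    using E
  proof (induction "f r - degree E r" arbitrary: E rule: less_induct)
    case less
    show ?case
    proof (cases "degree E r < f r")
      case True
      then obtain F where "partial_realization n f r F" "degree E r < degree F r"
        using partial_realization_augment[OF anti even slack[OF r] r less.prems] by blast
      then show ?thesis
        using less.hyps[of F] True by simp
    next
      case False
      have E: "simple_graph {1..n} E" "\<forall>i\<in>{1..n}. degree E i \<le> f i" "\<forall>i\<in>{1..<r}. degree E i = f i"
        "\<And>e. e \<in> E \<Longrightarrow> \<exists>x\<in>e. x \<le> r"
        using less.prems by (simp_all add: partial_realization_def)
      have "degree E r = f r"
        using False E(2) r by force
      then have "\<forall>i\<in>{1..<Suc r}. degree E i = f i"
        using E(3) by (metis atLeastLessThan_iff less_SucE)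
      moreover have "\<exists>x\<in>e. x \<le> Suc r" if "e \<in> E" for e
        using E(4)[OF that] le_SucI by blast
      ultimately have "partial_realization n f (Suc r) E"
        using E(1,2) unfolding partial_realization_def by blast
      then show ?thesis ..
    qed
  qed
  have "\<exists>E. partial_realization n f (Suc r) E" if "r \<le> n" for r
    using that
  proof (induction r)
    case 0
    have "partial_realization n f (Suc 0) {}"
      by (simp add: partial_realization_def simple_graph_def)
    then show ?case ..
  next
    case (Suc r)
    then show ?case
      using saturate[of "Suc r"] by auto
  qed
  then obtain E where "partial_realization n f (Suc n) E"
    by blast
  then have "realization n f E"
    by (simp add: realization_def partial_realization_def)
  then show ?thesis
    by (auto simp: graphic_def)
qed

section \<open>Matchings and reduced degree sequences\<close>

lemma degree_matching:
  assumes "pairwise disjnt M"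
  shows "degree M v = of_bool (v \<in> \<Union>M)"
proof (cases "v \<in> \<Union>M")
  case True
  then obtain e where "e \<in> M" "v \<in> e"
    by blast
  then have "{e \<in> M. v \<in> e} = {e}"
    using assms by (auto simp: pairwise_def disjnt_iff)
  then show ?thesis
    using True by (simp add: degree_def)
next
  case False
  then have "{e \<in> M. v \<in> e} = {}"
    by blast
  then have "degree M v = 0"
    by (simp only: degree_def card.empty)
  then show ?thesis
    using False by simp
qed

lemma pairwise_disjnt_if_degree_le_1:
  assumes "simple_graph V M" "\<And>v. v \<in> V \<Longrightarrow> degree M v \<le> 1"
  shows "pairwise disjnt M"
proof (rule pairwiseI, rule ccontr)
  fix e e' assume e: "e \<in> M" "e' \<in> M" "e \<noteq> e'" "\<not> disjnt e e'"
  then obtain v where v: "v \<in> e" "v \<in> e'"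
    by (auto simp: disjnt_iff)
  have "card {e, e'} \<le> card {e \<in> M. v \<in> e}"
    using e v simple_graph_finite_edges[OF assms(1)] by (intro card_mono) auto
  moreover have "v \<in> V"
    using e(1) v(1) assms(1) by (auto simp: simple_graph_def)
  ultimately show False
    using assms(2)[of v] e(3) by (simp add: degree_def)
qed

lemma card_Union_matching:
  assumes M: "simple_graph V M" and disj: "pairwise disjnt M"
  shows "card (\<Union>M) = 2 * card M"
proof -
  have "finite V" "\<Union>M \<subseteq> V"
    using M by (auto simp: simple_graph_def)
  then have "card (\<Union>M) = card {v \<in> V. v \<in> \<Union>M}"
    by (intro arg_cong[of _ _ card]) blast
  also have "\<dots> = (\<Sum>v\<in>V. degree M v)"
    unfolding degree_matching[OF disj] by (rule card_eq_sum_of_bool[OF \<open>finite V\<close>])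
  finally show ?thesis
    using sum_degree[OF M] by simp
qed

lemma matching_reduces_degrees:
  assumes E: "realization n d E" and M: "matching E M"
  shows "graphic n (\<lambda>i. d i - of_bool (i \<in> \<Union>M))" "\<Union>M \<subseteq> {1..n}" "card (\<Union>M) = 2 * card M"
proof -
  have G: "simple_graph {1..n} E" and deg: "\<And>i. i \<in> {1..n} \<Longrightarrow> degree E i = d i"
    and "M \<subseteq> E" and disj: "pairwise disjnt M"
    using E M by (auto simp: realization_def matching_def)
  have GM: "simple_graph {1..n} M"
    by (rule simple_graph_subset[OF G \<open>M \<subseteq> E\<close>])
  show "\<Union>M \<subseteq> {1..n}"
    using GM by (auto simp: simple_graph_def)
  show "card (\<Union>M) = 2 * card M"
    by (rule card_Union_matching[OF GM disj])
  have "degree (E - M) i = d i - of_bool (i \<in> \<Union>M)" if "i \<in> {1..n}" for i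
    using degree_exchange[OF simple_graph_finite_edges[OF G] \<open>M \<subseteq> E\<close>, of "{}" i] deg[OF that]
    unfolding degree_matching[OF disj] by simp
  then have "realization n (\<lambda>i. d i - of_bool (i \<in> \<Union>M)) (E - M)"
    using simple_graph_subset[OF G, of "E - M"] by (auto simp: realization_def)
  then show "graphic n (\<lambda>i. d i - of_bool (i \<in> \<Union>M))"
    by (auto simp: graphic_def)
qed

lemma matching_of_reduced_degrees:
  assumes "graphic n d" and "graphic n (\<lambda>i. d i - of_bool (i \<in> X))"
    and pos: "\<forall>i\<in>{1..n}. d i > 0" and X: "X \<subseteq> {1..n}"
  obtains E M where "realization n d E" "matching E M" "2 * card M = card X"
proof -
  obtain E E' where "realization n d E" "realization n (\<lambda>i. d i - of_bool (i \<in> X)) E'"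
    using assms by (auto simp: graphic_def)
  then have E: "simple_graph {1..n} E" "\<And>i. i \<in> {1..n} \<Longrightarrow> degree E i = d i"
    and E': "simple_graph {1..n} E'" "\<And>i. i \<in> {1..n} \<Longrightarrow> degree E' i = d i - of_bool (i \<in> X)"
    by (auto simp: realization_def)
  have "degree E' i \<le> degree E i \<and> degree E i \<le> degree E' i + 1" if "i \<in> {1..n}" for i
    using E(2)[OF that] E'(2)[OF that] by auto
  then obtain F F' where F: "simple_graph {1..n} F" "F' \<subseteq> F"
    and deg: "\<And>i. i \<in> {1..n} \<Longrightarrow> degree F i = degree E i"
      "\<And>i. i \<in> {1..n} \<Longrightarrow> degree F' i = degree E' i"
    using nested_realizations[OF E(1) E'(1)] by metis
  have GM: "simple_graph {1..n} (F - F')"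
    using simple_graph_subset[OF F(1)] by blast
  have degM: "degree (F - F') i = of_bool (i \<in> X)" if "i \<in> {1..n}" for i
  proof -
    have "degree (F - F') i + (d i - of_bool (i \<in> X)) = d i"
      using degree_exchange[OF simple_graph_finite_edges[OF F(1)] F(2), of "{}" i]
        deg[OF that] E(2)[OF that] E'(2)[OF that] by simp
    \<comment> \<open>This excludes truncation in \<open>d i - 1\<close>, so vertices of
      \<open>X\<close> get degree exactly one.\<close>
    moreover have "0 < d i"
      using pos that by blast
    ultimately show ?thesis
      by (cases "i \<in> X") simp_all
  qed
  have "2 * card (F - F') = (\<Sum>i\<in>{1..n}. degree (F - F') i)"
    using sum_degree[OF GM] by simp
  also have "\<dots> = (\<Sum>i\<in>{1..n}. of_bool (i \<in> X))"
    by (rule sum.cong[OF refl degM])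
  also have "\<dots> = card {i \<in> {1..n}. i \<in> X}"
    by (rule card_eq_sum_of_bool[symmetric]) simp
  also have "{i \<in> {1..n}. i \<in> X} = X"
    using X by blast
  finally have "2 * card (F - F') = card X" .
  moreover have "pairwise disjnt (F - F')"
    by (rule pairwise_disjnt_if_degree_le_1[OF GM]) (simp add: degM)
  then have "matching F (F - F')"
    by (auto simp: matching_def)
  moreover have "realization n d F"
    using F(1) deg(1) E(2) by (simp add: realization_def)
  ultimately show ?thesis
    using that by blast
qed

section \<open>Erdos-Gallai slacks of reduced sequences\<close>

lemma eg_slack_graphic_nonneg:
  assumes "graphic n f" "K \<subseteq> {1..n}"
  shows "0 \<le> eg_slack {1..n} f K"
proof -
  obtain E where E: "simple_graph {1..n} E" "\<And>i. i \<in> {1..n} \<Longrightarrow> degree E i = f i"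
    using assms by (auto simp: graphic_def realization_def)
  have "eg_slack {1..n} (degree E) K = eg_slack {1..n} f K"
    unfolding eg_slack_def using E(2) assms(2)
    by (intro arg_cong2[of _ _ _ _ minus] arg_cong2[of _ _ _ _ plus] refl sum.cong) auto
  then show ?thesis
    using eg_slack_degree_nonneg[OF E(1) assms(2)] by simp
qed

text \<open>Each vertex of \<open>X\<close> in \<open>K\<close> relieves the left side by one;
  outside \<open>K\<close> a minimum drops only where \<open>d i \<le> card K\<close>.\<close>

lemma eg_slack_reduce:
  assumes "finite V" "K \<subseteq> V" "X \<subseteq> V" and pos: "\<forall>i\<in>V. d i > 0"
  shows "eg_slack V (\<lambda>i. d i - of_bool (i \<in> X)) K
    = eg_slack V d K + int (card (X \<inter> K)) - int (card {i \<in> X - K. d i \<le> card K})"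
proof -
  have fin: "finite K" "finite (V - K)"
    using assms finite_subset by auto
  have "(\<Sum>i\<in>V - K. min (int (d i - of_bool (i \<in> X))) (int (card K)))
      = (\<Sum>i\<in>V - K. min (int (d i)) (int (card K)) - of_bool (i \<in> X \<and> d i \<le> card K))"
  proof (rule sum.cong)
    fix i assume "i \<in> V - K"
    then have "0 < d i"
      using pos by blast
    then show "min (int (d i - of_bool (i \<in> X))) (int (card K))
        = min (int (d i)) (int (card K)) - of_bool (i \<in> X \<and> d i \<le> card K)"
      by (auto simp: min_def)
  qed simp
  also have "\<dots> = (\<Sum>i\<in>V - K. min (int (d i)) (int (card K)))
      - int (card {i \<in> V - K. i \<in> X \<and> d i \<le> card K})"
    unfolding sum_subtractf card_eq_sum_of_bool[OF fin(2)] by simp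
  also have "{i \<in> V - K. i \<in> X \<and> d i \<le> card K} = {i \<in> X - K. d i \<le> card K}"
    using assms by blast
  finally have outer: "(\<Sum>i\<in>V - K. min (int (d i - of_bool (i \<in> X))) (int (card K)))
      = (\<Sum>i\<in>V - K. min (int (d i)) (int (card K))) - int (card {i \<in> X - K. d i \<le> card K})" .
  have "(\<Sum>i\<in>K. int (d i - of_bool (i \<in> X))) = (\<Sum>i\<in>K. int (d i) - of_bool (i \<in> X))"
  proof (rule sum.cong)
    fix i assume "i \<in> K"
    then have "0 < d i"
      using pos assms(2) by blast
    then show "int (d i - of_bool (i \<in> X)) = int (d i) - of_bool (i \<in> X)"
      by auto
  qed simp
  also have "\<dots> = (\<Sum>i\<in>K. int (d i)) - int (card {i \<in> K. i \<in> X})"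
    unfolding sum_subtractf card_eq_sum_of_bool[OF fin(1)] by simp
  also have "{i \<in> K. i \<in> X} = X \<inter> K"
    by blast
  finally show ?thesis
    unfolding eg_slack_def using outer by linarith
qed

text \<open>The slack changes by \<open>2k - f (k+1) - min (f (k+1)) k\<close> plus the growth of
  the later minima. The first part is nonnegative for \<open>f (k+1) \<le> k\<close>; for
  \<open>f (k+1) = k + 1\<close> it is \<open>-1\<close>, made up by the minimum at vertex
  \<open>k + 2\<close>.\<close>

lemma eg_slack_Suc_mono:
  assumes "k < n"
    and "f (Suc k) \<le> k \<or> f (Suc k) \<le> Suc k \<and> Suc (Suc k) \<le> n \<and> k < f (Suc (Suc k))"
  shows "eg_slack {1..n} f {1..k} \<le> eg_slack {1..n} f {1..Suc k}"
proof -
  define S where "S m j = (\<Sum>i\<in>{m..n}. min (int (f i)) (int j))" for m j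
  have le: "S m k \<le> S m (Suc k)" for m
    unfolding S_def by (intro sum_mono) auto
  have split: "S m j = min (int (f m)) (int j) + S (Suc m) j" if "m \<le> n" for m j
    unfolding S_def using that by (simp add: sum.atLeast_Suc_atMost)
  have slack: "eg_slack {1..n} f {1..j} = int j * (int j - 1) + S (Suc j) j - (\<Sum>i\<in>{1..j}. int (f i))"
    for j
  proof -
    have "{1..n} - {1..j} = {Suc j..n}"
      by auto
    then show ?thesis
      by (simp add: eg_slack_def S_def)
  qed
  have "S (Suc (Suc k)) k + of_bool (k < f (Suc k)) \<le> S (Suc (Suc k)) (Suc k)"
    using assms(2) le[of "Suc (Suc k)"] le[of "Suc (Suc (Suc k))"]
      split[of "Suc (Suc k)" k] split[of "Suc (Suc k)" "Suc k"] by auto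
  then show ?thesis
    unfolding slack using assms split[of "Suc k" k]
    by (cases "f (Suc k) \<le> k") (auto simp: algebra_simps min_def)
qed

text \<open>For \<open>k < \<mu>\<close> all of \<open>{1..k}\<close> is lowered; moving these
  \<open>k\<close> units to the right turns \<open>k * (k - 1)\<close> into
  \<open>k * k\<close>.\<close>

lemma condition_a_iff:
  assumes pos: "\<forall>i\<in>{1..n}. d i > 0" and "2 * \<mu> \<le> n"
  shows "condition_a n d \<mu> \<longleftrightarrow> (\<forall>k. 1 \<le> k \<and> k < \<mu> \<longrightarrow>
    0 \<le> eg_slack {1..n} (\<lambda>i. d i - of_bool (i \<in> {1..2 * \<mu>})) {1..k})"
proof -
  have "(\<Sum>i=1..k. int (d i)) \<le> (int k)\<^sup>2 + (\<Sum>i=k+1..n. min (int (d i) - of_bool (i \<le> 2 * \<mu>)) (int k))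
      \<longleftrightarrow> 0 \<le> eg_slack {1..n} (\<lambda>i. d i - of_bool (i \<in> {1..2 * \<mu>})) {1..k}"
    if k: "k < \<mu>" for k
  proof -
    have "{1..n} - {1..k} = {k+1..n}"
      by auto
    moreover have "(\<Sum>i\<in>{1..k}. int (d i - of_bool (i \<in> {1..2 * \<mu>}))) = (\<Sum>i\<in>{1..k}. int (d i) - 1)"
    proof (rule sum.cong)
      fix i assume "i \<in> {1..k}"
      then have "i \<in> {1..n}" "i \<in> {1..2 * \<mu>}"
        using k assms(2) by auto
      then have "0 < d i"
        using pos by blast
      then show "int (d i - of_bool (i \<in> {1..2 * \<mu>})) = int (d i) - 1"
        using \<open>i \<in> {1..2 * \<mu>}\<close> by simp
    qed simp
    moreover have "(\<Sum>i\<in>{k+1..n}. min (int (d i - of_bool (i \<in> {1..2 * \<mu>}))) (int k))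
        = (\<Sum>i=k+1..n. min (int (d i) - of_bool (i \<le> 2 * \<mu>)) (int k))"
    proof (rule sum.cong)
      fix i assume i: "i \<in> {k+1..n}"
      then have "i \<in> {1..n}"
        by simp
      then have "0 < d i"
        using pos by blast
      then show "min (int (d i - of_bool (i \<in> {1..2 * \<mu>}))) (int k)
          = min (int (d i) - of_bool (i \<le> 2 * \<mu>)) (int k)"
        using i by (auto simp: of_bool_def)
    qed simp
    ultimately show ?thesis
      by (simp add: eg_slack_def sum_subtractf power2_eq_square algebra_simps)
  qed
  then show ?thesis
    by (auto simp: condition_a_def)
qed

lemma downset_eq_atLeastAtMost:
  fixes S :: "nat set"
  assumes "S \<subseteq> {1..n}" "\<And>i j. i \<in> S \<Longrightarrow> 1 \<le> j \<Longrightarrow> j \<le> i \<Longrightarrow> j \<in> S"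
  obtains m where "m \<le> n" "S = {1..m}"
proof (cases "S = {}")
  case True
  then show ?thesis
    using that[of 0] by simp
next
  case False
  have fin: "finite S"
    using assms(1) finite_subset by blast
  have "S = {1..Max S}"
    using assms(1) assms(2)[OF Max_in[OF fin False]] Max_ge[OF fin] by auto
  moreover have "Max S \<le> n"
    using Max_in[OF fin False] assms(1) by auto
  ultimately show ?thesis
    using that by blast
qed

section \<open>The two conditions\<close>

text \<open>
  The vertices of degree \<open>d (2\<mu>)\<close> are \<open>a + 1, \<dots>, b\<close>. Vertices of equal degree are interchangeable,
  so \<open>X\<close> consists of \<open>{1..a}\<close> and the last (rather than the first) \<open>2\<mu> - a\<close> vertices of this block:
  then \<open>f\<close> is nonincreasing, and \<open>c\<close> is the number of vertices with \<open>f i \<ge> d (2\<mu>)\<close>, which is the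
  index \<open>2\<mu> + t (2\<mu>)\<close> of condition (b).
\<close>

locale degree_block =
  fixes n :: nat and d :: "nat \<Rightarrow> nat" and \<mu> a b :: nat
  assumes anti: "antimono_on {1..n} d" and pos: "\<forall>i\<in>{1..n}. d i > 0"
    and a_less: "a < 2 * \<mu>" and le_b: "2 * \<mu> \<le> b" and b_le: "b \<le> n"
    and above: "\<And>i. i \<in> {1..n} \<Longrightarrow> d (2 * \<mu>) < d i \<longleftrightarrow> i \<le> a"
    and below: "\<And>i. i \<in> {1..n} \<Longrightarrow> d (2 * \<mu>) \<le> d i \<longleftrightarrow> i \<le> b"
begin

definition c :: nat where "c = a + (b - 2 * \<mu>)"
definition X :: "nat set" where "X = {1..a} \<union> {c + 1..b}"
definition f :: "nat \<Rightarrow> nat" where "f i = d i - of_bool (i \<in> X)"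

lemma c_bounds: "a \<le> c" "c < b" "b - c = 2 * \<mu> - a" "c - a = b - 2 * \<mu>"
  using a_less le_b by (auto simp: c_def)

lemma block: "i \<in> {1..n} \<Longrightarrow> d i = d (2 * \<mu>) \<longleftrightarrow> a < i \<and> i \<le> b"
  using above[of i] below[of i] by auto

lemma X_subset: "X \<subseteq> {1..n}"
  using c_bounds b_le by (auto simp: X_def)

lemma X_parts: "X \<inter> {1..c} = {1..a}" "X - {1..c} = {c + 1..b}"
  using c_bounds by (auto simp: X_def)

lemma card_X: "card X = 2 * \<mu>"
proof -
  have "card X = card {1..a} + card {c + 1..b}"
    unfolding X_def using c_bounds by (intro card_Un_disjoint) auto
  then show ?thesis
    using c_bounds a_less by simp
qed

lemma f_antimono: "antimono_on {1..n} f"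
proof (rule monotone_onI)
  fix i j assume ij: "i \<in> {1..n}" "j \<in> {1..n}" "i \<le> j"
  have "d j \<le> d i"
    by (rule monotone_onD[OF anti ij])
  show "f j \<le> f i"
  \<comment> \<open>Only \<open>i \<in> X\<close>, \<open>j \<notin> X\<close> could reverse the
    order; then \<open>i\<close> lies before the block and \<open>j\<close> does not, or
    \<open>j\<close> lies past it and \<open>i\<close> does not, so \<open>d\<close> drops
    strictly.\<close>
  proof (cases "i \<in> X \<and> j \<notin> X")
    case True
    then have "d j < d i"
      using above[of i] above[of j] below[of i] below[of j] c_bounds ij
      by (auto simp: X_def not_le)
    then show ?thesis
      using True by (simp add: f_def)
  next
    case False
    then show ?thesis
      using \<open>d j \<le> d i\<close> by (auto simp: f_def)
  qed
qed

lemma slack_f: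
  assumes "K \<subseteq> {1..n}"
  shows "eg_slack {1..n} f K = eg_slack {1..n} d K + int (card (X \<inter> K))
    - int (card {i \<in> X - K. d i \<le> card K})"
  unfolding f_def by (rule eg_slack_reduce) (use assms X_subset pos in auto)

text \<open>Up to \<open>c\<close>, the set \<open>X\<close> is \<open>{1..a}\<close>, and
  \<open>a\<close> is \<open>c\<close> minus the number of block vertices after
  \<open>2 * \<mu>\<close>. After \<open>c\<close>, it is exactly the rest of the block, so
  membership reads \<open>d i = d (2 * \<mu>)\<close>.\<close>

lemma condition_b_iff: "condition_b n d \<mu> \<longleftrightarrow> 0 \<le> eg_slack {1..n} f {1..c}"
proof -
  have mu: "1 \<le> 2 * \<mu>" "2 * \<mu> \<le> n"
    using a_less le_b b_le by auto
  have gt: "{i \<in> {1..n}. 2 * \<mu> < i \<and> d i = d (2 * \<mu>)} = {2 * \<mu> + 1..b}"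
    using block a_less b_le by auto
  have le: "{i \<in> {1..n}. i \<le> 2 * \<mu> \<and> d i = d (2 * \<mu>)} = {a + 1..2 * \<mu>}"
    using block le_b mu by auto
  have k: "nat (int (2 * \<mu>) + tshift n d (2 * \<mu>)) = c"
    unfolding tshift_def gt le using a_less le_b by (simp add: c_def)
  have dpos: "0 < d i" if "i \<in> {1..n}" for i
    using pos that by blast
  have "(\<Sum>i\<in>{1..c}. int (f i)) = (\<Sum>i\<in>{1..c}. int (d i) - of_bool (i \<in> X))"
  proof (rule sum.cong)
    fix i assume "i \<in> {1..c}"
    then have "0 < d i"
      using dpos[of i] c_bounds b_le by auto
    then show "int (f i) = int (d i) - of_bool (i \<in> X)"
      by (auto simp: f_def)
  qed simp
  also have "\<dots> = (\<Sum>i\<in>{1..c}. int (d i)) - (\<Sum>i\<in>{1..c}. of_bool (i \<in> X))"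
    by (rule sum_subtractf)
  also have "(\<Sum>i\<in>{1..c}. of_bool (i \<in> X)) = int (card {1..a})"
    using X_parts(1) by (simp add: of_bool_def sum.If_cases Int_commute)
  finally have inner: "(\<Sum>i\<in>{1..c}. int (f i)) = (\<Sum>i\<in>{1..c}. int (d i)) - int a"
    by simp
  have outer: "(\<Sum>i\<in>{c + 1..n}. min (int (f i)) (int c))
      = (\<Sum>i\<in>{c + 1..n}. min (int (d i) - of_bool (d i = d (2 * \<mu>))) (int c))"
  proof (rule sum.cong)
    fix i assume i: "i \<in> {c + 1..n}"
    then have "i \<in> X \<longleftrightarrow> a < i \<and> i \<le> b"
      using c_bounds(1) by (simp add: X_def)
    then have "i \<in> X \<longleftrightarrow> d i = d (2 * \<mu>)"
      using block[of i] i by simp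
    moreover have "0 < d i"
      using dpos[of i] i by auto
    ultimately have "int (f i) = int (d i) - of_bool (d i = d (2 * \<mu>))"
      by (auto simp: f_def)
    then show "min (int (f i)) (int c) = min (int (d i) - of_bool (d i = d (2 * \<mu>))) (int c)"
      by simp
  qed simp
  have "{1..n} - {1..c} = {c + 1..n}"
    by auto
  then have "eg_slack {1..n} f {1..c} = int c * (int c - 1)
      + (\<Sum>i\<in>{c + 1..n}. min (int (f i)) (int c)) - (\<Sum>i\<in>{1..c}. int (f i))"
    by (simp add: eg_slack_def)
  moreover have "int (card {2 * \<mu> + 1..b}) = int c - int a"
    using c_bounds le_b by auto
  ultimately show ?thesis
    unfolding condition_b_def Let_def k gt using inner outer by linarith
qed

text \<open>
  The inequality for \<open>f\<close> at \<open>k\<close> follows from that for \<open>d\<close> when at most as many vertices of \<open>X\<close>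
  after \<open>k\<close> have degree at most \<open>k\<close> as there are vertices of \<open>X\<close> up to \<open>k\<close>. This settles
  \<open>k < d (2\<mu>)\<close> and \<open>\<mu> \<le> k \<le> a\<close>. On \<open>{a..c - 1}\<close> and on \<open>{c..n}\<close> the slack does not
  decrease from \<open>k = d (2\<mu>) - 1\<close> on, which reduces these ranges to \<open>a\<close> and to condition (b).
\<close>

lemma eg_slack_f_nonneg:
  assumes graphic: "graphic n d" and A: "condition_a n d \<mu>" and B: "condition_b n d \<mu>"
    and "k \<le> n"
  shows "0 \<le> eg_slack {1..n} f {1..k}"
proof -
  have trivial: "0 \<le> eg_slack {1..n} f {1..k}"
    if "k \<le> n" "card {i \<in> X - {1..k}. d i \<le> k} \<le> card (X \<inter> {1..k})" for k
    using slack_f[of "{1..k}"] eg_slack_graphic_nonneg[OF graphic, of "{1..k}"] that by simp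
  have small: "0 \<le> eg_slack {1..n} f {1..k}" if "k \<le> n" "k < d (2 * \<mu>)" for k
  proof (rule trivial[OF \<open>k \<le> n\<close>])
    have "d (2 * \<mu>) \<le> d i" if "i \<in> X" for i
      using below[of i] that X_subset c_bounds by (auto simp: X_def)
    then have "{i \<in> X - {1..k}. d i \<le> k} = {}"
      using that(2) by force
    then show "card {i \<in> X - {1..k}. d i \<le> k} \<le> card (X \<inter> {1..k})"
      by (metis card.empty le0)
  qed
  have le_a: "0 \<le> eg_slack {1..n} f {1..k}" if "k \<le> a" for k
  proof -
    have "k \<le> n"
      using that c_bounds b_le by simp
    have Xk: "X \<inter> {1..k} = {1..k}"
      using that by (auto simp: X_def)
    consider "k < d (2 * \<mu>)" | "\<mu> \<le> k" | "d (2 * \<mu>) \<le> k" "k < \<mu>"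
      by linarith
    then show ?thesis
    proof cases
      case 1
      then show ?thesis
        using small \<open>k \<le> n\<close> by blast
    next
      case 2
      have "finite X"
        by (simp add: X_def)
      then have "card {i \<in> X - {1..k}. d i \<le> k} \<le> card (X - {1..k})"
        by (intro card_mono) auto
      also have "\<dots> = 2 * \<mu> - k"
        using card_Diff_subset_Int[of X "{1..k}"] Xk card_X by simp
      finally show ?thesis
        using trivial[OF \<open>k \<le> n\<close>] Xk 2 by simp
    next
      case 3
      \<comment> \<open>Condition (a) concerns \<open>{1..2 * \<mu>}\<close>. Passing to
        \<open>X\<close> replaces \<open>{a + 1..2 * \<mu>}\<close> by equally many vertices
        \<open>{c + 1..b}\<close> of the block, so no more is lost at \<open>k\<close>.\<close>
      let ?L = "{i \<in> {k + 1..a}. d i \<le> k}"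
      have dpos: "0 < d (2 * \<mu>)"
        using pos a_less le_b b_le by auto
      have "d i \<le> k" if "i \<in> {a + 1..2 * \<mu>}" for i
        using above[of i] that 3(1) le_b b_le by simp
      then have "{i \<in> {1..2 * \<mu>} - {1..k}. d i \<le> k} = ?L \<union> {a + 1..2 * \<mu>}"
        using \<open>k \<le> a\<close> a_less by auto
      moreover have "card (?L \<union> {a + 1..2 * \<mu>}) = card ?L + card {a + 1..2 * \<mu>}"
        by (rule card_Un_disjoint) auto
      ultimately have loss: "card {i \<in> {1..2 * \<mu>} - {1..k}. d i \<le> k} = card ?L + (2 * \<mu> - a)"
        by simp
      have "{1..2 * \<mu>} \<inter> {1..k} = {1..k}"
        using 3 by auto
      moreover have "0 \<le> eg_slack {1..n} (\<lambda>i. d i - of_bool (i \<in> {1..2 * \<mu>})) {1..k}"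
        using A 3 dpos le_b b_le condition_a_iff[OF pos, of \<mu>] by simp
      moreover have "eg_slack {1..n} (\<lambda>i. d i - of_bool (i \<in> {1..2 * \<mu>})) {1..k}
          = eg_slack {1..n} d {1..k} + int (card ({1..2 * \<mu>} \<inter> {1..k}))
          - int (card {i \<in> {1..2 * \<mu>} - {1..k}. d i \<le> card {1..k}})"
        by (rule eg_slack_reduce) (use \<open>k \<le> n\<close> le_b b_le pos in auto)
      ultimately have "0 \<le> eg_slack {1..n} d {1..k} + int k - int (card ?L + (2 * \<mu> - a))"
        using loss by simp
      moreover have "{i \<in> X - {1..k}. d i \<le> k} \<subseteq> ?L \<union> {c + 1..b}"
        by (auto simp: X_def)
      then have "card {i \<in> X - {1..k}. d i \<le> k} \<le> card (?L \<union> {c + 1..b})"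
        by (rule card_mono[rotated]) simp
      then have "card {i \<in> X - {1..k}. d i \<le> k} \<le> card ?L + card {c + 1..b}"
        using card_Un_le le_trans by blast
      ultimately show ?thesis
        using slack_f[of "{1..k}"] \<open>k \<le> n\<close> Xk c_bounds by simp
    qed
  qed
  have f_block: "f i = d (2 * \<mu>)" if "i \<in> {a + 1..c}" for i
    using block[of i] that c_bounds b_le by (auto simp: f_def X_def)
  have f_late: "f i \<le> d (2 * \<mu>) - 1" if "i \<in> {c + 1..n}" for i
    using block[of i] below[of i] that c_bounds by (cases "i \<le> b") (auto simp: f_def X_def)
  \<comment> \<open>Vertices \<open>m + 1\<close> and \<open>m + 2\<close> both keep the value
    \<open>d (2 * \<mu>)\<close>, so the second compensates when this value is \<open>m + 1\<close>.
    The step into \<open>c\<close> lacks such a vertex, whence condition (b).\<close>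
  have less_c: "0 \<le> eg_slack {1..n} f {1..k}" if "a \<le> k" "k < c" for k
    using \<open>a \<le> k\<close>
  proof (induction k rule: dec_induct)
    case base
    show ?case
      by (rule le_a) simp
  next
    case (step m)
    have m: "Suc (Suc m) \<le> c" "Suc (Suc m) \<le> n"
      using step.hyps that c_bounds b_le by auto
    show ?case
    proof (cases "Suc m < d (2 * \<mu>)")
      case True
      then show ?thesis
        using small m by simp
    next
      case False
      have "f (Suc m) = d (2 * \<mu>)" "f (Suc (Suc m)) = d (2 * \<mu>)"
        using f_block step.hyps m by auto
      then have "eg_slack {1..n} f {1..m} \<le> eg_slack {1..n} f {1..Suc m}"
        using False m by (intro eg_slack_Suc_mono) auto
      then show ?thesis
        using step.IH by simp
    qed
  qed
  have ge_c: "0 \<le> eg_slack {1..n} f {1..k}" if "c \<le> k" "k \<le> n" for k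
    using \<open>c \<le> k\<close>
  proof (induction k rule: dec_induct)
    case base
    show ?case
      using B condition_b_iff by blast
  next
    case (step m)
    show ?case
    proof (cases "Suc m < d (2 * \<mu>)")
      case True
      then show ?thesis
        using small step.hyps that by simp
    next
      case False
      have "f (Suc m) \<le> m"
        using f_late[of "Suc m"] False step.hyps that by simp
      then have "eg_slack {1..n} f {1..m} \<le> eg_slack {1..n} f {1..Suc m}"
        using step.hyps that by (intro eg_slack_Suc_mono) auto
      then show ?thesis
        using step.IH by simp
    qed
  qed
  show ?thesis
    using le_a less_c ge_c \<open>k \<le> n\<close> by (meson nat_le_linear not_le)
qed

lemma ex_matching:
  assumes "graphic n d" "condition_a n d \<mu>" "condition_b n d \<mu>"
  obtains E M where "realization n d E" "matching E M" "card M = \<mu>"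
proof -
  obtain E where E: "simple_graph {1..n} E" "\<And>i. i \<in> {1..n} \<Longrightarrow> degree E i = d i"
    using assms(1) by (auto simp: graphic_def realization_def)
  \<comment> \<open>Lowering \<open>2 * \<mu>\<close> degrees by one keeps the degree sum
    even.\<close>
  have "d i = f i + of_bool (i \<in> X)" if "i \<in> {1..n}" for i
    using pos that by (auto simp: f_def)
  then have "(\<Sum>i\<in>{1..n}. d i) = (\<Sum>i\<in>{1..n}. f i) + (\<Sum>i\<in>{1..n}. of_bool (i \<in> X))"
    by (simp add: sum.distrib)
  also have "(\<Sum>i\<in>{1..n}. of_bool (i \<in> X)) = card {i \<in> {1..n}. i \<in> X}"
    by (rule card_eq_sum_of_bool[symmetric]) simp
  also have "{i \<in> {1..n}. i \<in> X} = X"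
    using X_subset by blast
  finally have "(\<Sum>i\<in>{1..n}. f i) + 2 * \<mu> = 2 * card E"
    using sum_degree[OF E(1)] E(2) card_X by simp
  then have "even (\<Sum>i\<in>{1..n}. f i)"
    by (metis dvd_triv_left even_add)
  then have "graphic n f"
    using erdos_gallai[OF f_antimono] eg_slack_f_nonneg[OF assms] by simp
  then have "graphic n (\<lambda>i. d i - of_bool (i \<in> X))"
    by (simp add: f_def[abs_def])
  then obtain E M where "realization n d E" "matching E M" "2 * card M = card X"
    using matching_of_reduced_degrees[OF assms(1) _ pos X_subset] by blast
  then show ?thesis
    using that card_X by simp
qed

text \<open>
  Vertices of the block in \<open>Y\<close> have smaller reduced degree, so the inequality of \<open>{1..c}\<close> is
  compared with that of \<open>{1..a} \<union> Q\<close>, where \<open>Q\<close> meets \<open>Y\<close> as little as possible.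
\<close>

lemma reduced_graphic_condition_b:
  assumes Y: "graphic n (\<lambda>i. d i - of_bool (i \<in> Y))" "Y \<subseteq> {1..n}" "card Y = 2 * \<mu>"
  shows "condition_b n d \<mu>"
proof -
  let ?B = "{a + 1..b}"
  have finY: "finite Y"
    using Y(2) finite_subset by blast
  \<comment> \<open>\<open>Q\<close> consists of \<open>c - a\<close> block vertices: all outside
    \<open>Y\<close> if there are enough, otherwise including every block vertex outside
    \<open>Y\<close>.\<close>
  obtain Q where Q: "Q \<subseteq> ?B" "card Q = b - 2 * \<mu>" "Q \<inter> Y = {} \<or> ?B - Q \<subseteq> Y"
  proof (cases "b - 2 * \<mu> \<le> card (?B - Y)")
    case True
    then obtain Q where "Q \<subseteq> ?B - Y" "card Q = b - 2 * \<mu>"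
      by (rule obtain_subset_with_card_n)
    then show ?thesis
      using that[of Q] by blast
  next
    case False
    then obtain Q where "?B - Y \<subseteq> Q" "Q \<subseteq> ?B" "card Q = b - 2 * \<mu>"
      using exists_subset_between[of "?B - Y" "b - 2 * \<mu>" ?B] a_less by fastforce
    then show ?thesis
      using that[of Q] by blast
  qed
  define K where "K = {1..a} \<union> Q"
  have finQ: "finite Q"
    using Q(1) finite_subset by blast
  have sum_K: "(\<Sum>i\<in>{1..a} \<union> R. h (d i)) = (\<Sum>i\<in>{1..a}. h (d i)) + int (card R) * h (d (2 * \<mu>))"
    if "R \<subseteq> ?B" for R and h :: "nat \<Rightarrow> int"
  proof -
    have "finite R"
      using that finite_subset by blast
    then have "(\<Sum>i\<in>{1..a} \<union> R. h (d i)) = (\<Sum>i\<in>{1..a}. h (d i)) + (\<Sum>i\<in>R. h (d i))"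
      using that by (intro sum.union_disjoint) auto
    also have "(\<Sum>i\<in>R. h (d i)) = (\<Sum>i\<in>R. h (d (2 * \<mu>)))"
    proof (rule sum.cong)
      fix i assume "i \<in> R"
      then have "a < i" "i \<le> b" "i \<in> {1..n}"
        using that b_le by auto
      then show "h (d i) = h (d (2 * \<mu>))"
        using block by metis
    qed simp
    finally show ?thesis
      by simp
  qed
  have c_eq: "{1..c} = {1..a} \<union> {a + 1..c}"
    using c_bounds by auto
  have K: "K \<subseteq> {1..n}" "{1..c} \<subseteq> {1..n}"
    using Q(1) b_le c_bounds by (auto simp: K_def)
  have "card K = card {1..a} + card Q"
    unfolding K_def using finQ Q(1) by (intro card_Un_disjoint) auto
  then have card_K: "card K = c"
    using Q(2) c_bounds by (simp add: c_def)
  \<comment> \<open>Both \<open>K\<close> and \<open>{1..c}\<close> add \<open>c - a\<close> block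
    vertices to \<open>{1..a}\<close>, so they carry the same degrees.\<close>
  have sums: "(\<Sum>i\<in>K. h (d i)) = (\<Sum>i\<in>{1..c}. h (d i))" for h :: "nat \<Rightarrow> int"
    unfolding K_def c_eq using sum_K[OF Q(1), of h] sum_K[of "{a + 1..c}" h] Q(2) c_bounds by simp
  have "(\<Sum>i\<in>{1..n} - K. min (int (d i)) (int c)) = (\<Sum>i\<in>{1..n} - {1..c}. min (int (d i)) (int c))"
    unfolding sum_diff[OF finite_atLeastAtMost K(1)] sum_diff[OF finite_atLeastAtMost K(2)]
    using sums[of "\<lambda>x. min (int x) (int c)"] by (simp only:)
  then have slack_K: "eg_slack {1..n} d K = eg_slack {1..n} d {1..c}"
    unfolding eg_slack_def card_K using sums[of int] by simp
  \<comment> \<open>In the second case the \<open>2 * \<mu> - a\<close> block vertices outside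
    \<open>Q\<close> use up that many elements of \<open>Y\<close>.\<close>
  have "card (Y \<inter> K) \<le> a"
    using Q(3)
  proof
    assume "Q \<inter> Y = {}"
    then have "card (Y \<inter> K) \<le> card {1..a}"
      by (intro card_mono) (auto simp: K_def)
    then show ?thesis
      by simp
  next
    assume "?B - Q \<subseteq> Y"
    then have "?B - Q \<subseteq> Y - K"
      by (auto simp: K_def)
    then have "card (?B - Q) \<le> card (Y - K)"
      using finY by (intro card_mono) auto
    moreover have "card (?B - Q) = 2 * \<mu> - a"
      using card_Diff_subset[OF finQ Q(1)] Q(2) a_less le_b by simp
    ultimately show ?thesis
      using card_Diff_subset_Int[of Y K] finY Y(3) a_less card_mono[OF finY, of "Y \<inter> K"] by simp
  qed
  have "0 \<le> eg_slack {1..n} (\<lambda>i. d i - of_bool (i \<in> Y)) K"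
    by (rule eg_slack_graphic_nonneg[OF Y(1) K(1)])
  also have "\<dots> = eg_slack {1..n} d {1..c} + int (card (Y \<inter> K)) - int (card {i \<in> Y - K. d i \<le> c})"
    using eg_slack_reduce[OF _ K(1) Y(2) pos] slack_K by (simp add: card_K)
  finally have loss: "int (card {i \<in> Y - K. d i \<le> c}) \<le> eg_slack {1..n} d {1..c} + int (card (Y \<inter> K))"
    by simp
  \<comment> \<open>If \<open>d (2 * \<mu>) \<le> c\<close>, all of \<open>Y - K\<close> is lost, so
    the slack of \<open>d\<close> is at least \<open>2 * \<mu> - 2 * card (Y \<inter> K)\<close>,
    hence at least the \<open>2 * \<mu> - 2 * a\<close> that suffices for \<open>X\<close>.
    Otherwise \<open>X\<close> loses nothing after \<open>c\<close>.\<close>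
  have "0 \<le> eg_slack {1..n} d {1..c} + int a - int (card {i \<in> X - {1..c}. d i \<le> c})"
  proof (cases "d (2 * \<mu>) \<le> c")
    case True
    have "d i \<le> c" if "i \<in> Y - K" for i
    proof -
      have "i \<in> {1..n}" "\<not> i \<le> a"
        using that Y(2) by (auto simp: K_def)
      then show ?thesis
        using above[of i] True by simp
    qed
    then have "{i \<in> Y - K. d i \<le> c} = Y - K"
      by blast
    then have "card {i \<in> Y - K. d i \<le> c} = 2 * \<mu> - card (Y \<inter> K)"
      using card_Diff_subset_Int[of Y K] finY Y(3) by simp
    moreover have "card {i \<in> X - {1..c}. d i \<le> c} \<le> card {c + 1..b}"
      unfolding X_parts by (intro card_mono) auto
    then have "card {i \<in> X - {1..c}. d i \<le> c} \<le> 2 * \<mu> - a"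
      using c_bounds by simp
    ultimately show ?thesis
      using loss \<open>card (Y \<inter> K) \<le> a\<close> a_less by linarith
  next
    case False
    have "d (2 * \<mu>) \<le> d i" if "i \<in> {c + 1..b}" for i
      using below[of i] that b_le by simp
    then have "{i \<in> X - {1..c}. d i \<le> c} = {}"
      unfolding X_parts using False by force
    then have "card {i \<in> X - {1..c}. d i \<le> c} = 0"
      by (simp only: card.empty)
    then show ?thesis
      using loss \<open>card (Y \<inter> K) \<le> a\<close> by linarith
  qed
  then show ?thesis
    unfolding condition_b_iff slack_f[OF K(2)] X_parts(1) by simp
qed

end

section \<open>Existence of the block and necessity of condition (a)\<close>

lemma antimono_threshold:
  assumes "antimono_on {1..n} (d :: nat \<Rightarrow> nat)"
  obtains m where "m \<le> n" "\<And>i. i \<in> {1..n} \<Longrightarrow> x < d i \<longleftrightarrow> i \<le> m"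
proof -
  have "j \<in> {i \<in> {1..n}. x < d i}" if "i \<in> {i \<in> {1..n}. x < d i}" "1 \<le> j" "j \<le> i" for i j
    using monotone_onD[OF assms, of j i] that by auto
  then obtain m where "m \<le> n" "{i \<in> {1..n}. x < d i} = {1..m}"
    using downset_eq_atLeastAtMost[of "{i \<in> {1..n}. x < d i}" n] by blast
  then show ?thesis
    using that[of m] by (auto simp: set_eq_iff)
qed

lemma degree_block_exists:
  assumes anti: "antimono_on {1..n} d" and pos: "\<forall>i\<in>{1..n}. d i > 0"
    and mu: "1 \<le> 2 * \<mu>" "2 * \<mu> \<le> n"
  obtains a b where "degree_block n d \<mu> a b"
proof -
  have mem: "2 * \<mu> \<in> {1..n}"
    using mu by simp
  obtain a where a: "\<And>i. i \<in> {1..n} \<Longrightarrow> d (2 * \<mu>) < d i \<longleftrightarrow> i \<le> a"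
    using antimono_threshold[OF anti] by blast
  \<comment> \<open>By positivity, subtracting one turns the weak inequality of \<open>below\<close>
    into a strict threshold.\<close>
  obtain b where b: "b \<le> n" "\<And>i. i \<in> {1..n} \<Longrightarrow> d (2 * \<mu>) - 1 < d i \<longleftrightarrow> i \<le> b"
    using antimono_threshold[OF anti] by blast
  have "0 < d (2 * \<mu>)"
    using pos mem by blast
  then have below: "d (2 * \<mu>) \<le> d i \<longleftrightarrow> i \<le> b" if "i \<in> {1..n}" for i
    using b(2)[OF that] by auto
  have "degree_block n d \<mu> a b"
    using anti pos a a[OF mem] b(1) below below[OF mem] by unfold_locales auto
  then show ?thesis
    using that by blast
qed

text \<open>At \<open>k < \<mu>\<close> no set of size \<open>2 * \<mu>\<close> does better than
  \<open>{1..2 * \<mu>}\<close>: it contains all of \<open>{1..k}\<close> and as few later vertices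
  of degree at most \<open>k\<close> as possible.\<close>

lemma reduced_graphic_condition_a:
  assumes anti: "antimono_on {1..n} d" and pos: "\<forall>i\<in>{1..n}. d i > 0"
    and Y: "graphic n (\<lambda>i. d i - of_bool (i \<in> Y))" "Y \<subseteq> {1..n}" "card Y = 2 * \<mu>"
  shows "condition_a n d \<mu>"
proof -
  have finY: "finite Y"
    using Y(2) finite_subset by blast
  have mu: "2 * \<mu> \<le> n"
    using card_mono[OF _ Y(2)] Y(3) by simp
  have "0 \<le> eg_slack {1..n} (\<lambda>i. d i - of_bool (i \<in> {1..2 * \<mu>})) {1..k}" if k: "k < \<mu>" for k
  proof -
    have kn: "{1..k} \<subseteq> {1..n}" "{1..2 * \<mu>} \<subseteq> {1..n}"
      using k mu by auto
    obtain h where h: "\<And>i. i \<in> {1..n} \<Longrightarrow> k < d i \<longleftrightarrow> i \<le> h"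
      using antimono_threshold[OF anti] by blast
    have le: "d i \<le> k \<longleftrightarrow> h < i" if "i \<in> {1..n}" for i
      using h[OF that] by auto
    \<comment> \<open>The vertices after \<open>k\<close> of degree at most \<open>k\<close> are
      those past \<open>max h k\<close>, and at most \<open>max h k\<close> elements of
      \<open>Y\<close> avoid them.\<close>
    have "{i \<in> {1..2 * \<mu>} - {1..k}. d i \<le> k} = {max h k + 1..2 * \<mu>}"
      using le kn by auto
    then have "card {i \<in> {1..2 * \<mu>} - {1..k}. d i \<le> k} = 2 * \<mu> - max h k"
      by simp
    also have "\<dots> \<le> card (Y - {1..max h k})"
      using diff_card_le_card_Diff[of "{1..max h k}" Y] Y(3) by simp
    also have "Y - {1..max h k} = {i \<in> Y - {1..k}. d i \<le> k}"
      using le Y(2) by auto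
    finally have loss: "card {i \<in> {1..2 * \<mu>} - {1..k}. d i \<le> k} \<le> card {i \<in> Y - {1..k}. d i \<le> k}" .
    have "card (Y \<inter> {1..k}) \<le> card {1..k}"
      by (intro card_mono) auto
    moreover have "{1..2 * \<mu>} \<inter> {1..k} = {1..k}"
      using k by auto
    ultimately have "card (Y \<inter> {1..k}) \<le> card ({1..2 * \<mu>} \<inter> {1..k})"
      by (simp only:)
    moreover have "0 \<le> eg_slack {1..n} (\<lambda>i. d i - of_bool (i \<in> Y)) {1..k}"
      by (rule eg_slack_graphic_nonneg[OF Y(1) kn(1)])
    moreover have "card {1..k} = k"
      by simp
    note eg_slack_reduce[OF finite_atLeastAtMost kn(1) Y(2) pos, unfolded this]
      eg_slack_reduce[OF finite_atLeastAtMost kn(1) kn(2) pos, unfolded this]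
    ultimately show ?thesis
      using loss by linarith
  qed
  then show ?thesis
    using condition_a_iff[OF pos mu] by blast
qed

theorem theorem2p15:
  fixes n :: nat and d :: "nat \<Rightarrow> nat"
  assumes "n \<ge> 1"
    and "graphic n d"
    and "antimono_on {1..n} d"
    and "\<forall>i\<in>{1..n}. d i > 0"
  defines "S \<equiv> {\<mu>. 1 \<le> 2 * \<mu> \<and> 2 * \<mu> \<le> n \<and> condition_a n d \<mu> \<and> condition_b n d \<mu>}"
  shows "S \<noteq> {} \<and> max_matching_number n d = Max S"
proof -
  note fin_real = realization_matching_numbers_finite_nonempty[OF assms(2)]
  have le_max: "card M \<le> max_matching_number n d" if "realization n d E" "matching E M" for E M
  proof -
    have "simple_graph {1..n} E"
      using that by (simp add: realization_def)
    then have "card M \<le> matching_number E"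
      unfolding matching_number_def using that(2)
      by (intro Max_ge) (auto simp: matching_sizes_finite_nonempty)
    also have "\<dots> \<le> max_matching_number n d"
      unfolding max_matching_number_def using that(1) by (intro Max_ge fin_real) auto
    finally show ?thesis .
  qed
  have upper: "\<mu> \<le> max_matching_number n d" if "\<mu> \<in> S" for \<mu>
  proof -
    from that obtain a b where "degree_block n d \<mu> a b"
      using degree_block_exists[OF assms(3,4)] by (auto simp: S_def)
    then obtain E M where "realization n d E" "matching E M" "card M = \<mu>"
      using degree_block.ex_matching[of n d \<mu> a b] assms(2) \<open>\<mu> \<in> S\<close> by (auto simp: S_def)
    then show ?thesis
      using le_max by blast
  qed
  have "max_matching_number n d \<in> {matching_number E | E. realization n d E}"
    unfolding max_matching_number_def using fin_real by (rule Max_in)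
  then obtain E where E: "realization n d E" "matching_number E = max_matching_number n d"
    by auto
  then have G: "simple_graph {1..n} E"
    by (simp add: realization_def)
  have "matching_number E \<in> {card M | M. matching E M}"
    unfolding matching_number_def using matching_sizes_finite_nonempty[OF G] by (rule Max_in)
  then obtain M where M: "matching E M" "card M = max_matching_number n d"
    using E(2) by auto
  \<comment> \<open>\<open>S\<close> admits only \<open>\<mu> \<ge> 1\<close>; an edge at vertex 1
    is a matching of size one.\<close>
  have "degree E 1 = d 1" "0 < d 1"
    using E(1) assms(1,4) by (auto simp: realization_def)
  then have "E \<noteq> {}"
    by auto
  then obtain e where "matching E {e}"
    by (auto simp: matching_def)
  then have pos: "1 \<le> max_matching_number n d"
    using le_max[OF E(1), of "{e}"] by simp
  \<comment> \<open>The vertices covered by a largest matching form the set \<open>Y\<close> of both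
    necessity lemmas, so the maximum itself lies in \<open>S\<close>.\<close>
  note red = matching_reduces_degrees[OF E(1) M(1)]
  have "2 * max_matching_number n d \<le> n"
    using card_mono[OF _ red(2)] red(3) M(2) by simp
  moreover from this obtain a b where "degree_block n d (max_matching_number n d) a b"
    using degree_block_exists[OF assms(3,4), of "max_matching_number n d"] pos by auto
  then have "condition_b n d (max_matching_number n d)"
    using degree_block.reduced_graphic_condition_b[OF _ red(1,2)] red(3) M(2) by simp
  moreover have "condition_a n d (max_matching_number n d)"
    using reduced_graphic_condition_a[OF assms(3,4) red(1,2)] red(3) M(2) by simp
  ultimately have mem: "max_matching_number n d \<in> S"
    using pos by (simp add: S_def)
  have "finite S"
    by (rule finite_subset[of _ "{..n}"]) (auto simp: S_def)
  then have "Max S = max_matching_number n d"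
    using upper mem by (intro Max_eqI) auto
  then show ?thesis
    using mem by auto
qed

end
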